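(* Let $(\mathcal C,A)$ be a unirational differential curve, with $A\in\mathcal F\{x,y\}$ irreducible. If $\mathcal P_1(u)$ and $\mathcal P_2(u)$ are two proper differential rational parametrizations of $(\mathcal C,A)$, then there exist $a,b,c,d\in\mathcal F$ such that $\mathcal P_2(u)=\mathcal P_1\big(\frac{au+b}{cu+d}\big)$. Conversely, given any proper differential rational parametrization $\mathcal P(u)$ of $(\mathcal C,A)$, $\mathcal P\big(\frac{au+b}{cu+d}\big)$ is also a proper differential rational parametrization of $(\mathcal C,A)$ for all $a,b,c,d\in\mathcal F$ with $ad-bc\neq0$.
   Context: $\mathcal F$ is an ordinary differential field of characteristic $0$ with derivation $\delta$, and $\mathcal E$ is a fixed universal differential extension field of $\mathcal F$; $x,y$ are differential indeterminates over $\mathcal E$, and $u\in\mathcal E$ is differentially transcendental over $\mathcal F$. $\mathcal F\{S\}$ and $\mathcal F\langle S\rangle$ denote the differential ring and differential field generated by $S$ over $\mathcal F$. Differential curves: for an irreducible $A\in\mathcal F\{x,y\}\setminus\mathcal F$, $\mathrm{sat}(A)=[A]:S_A^\infty=\{f:\exists m,\ S_A^mf\in[A]\}$, where $[A]$ is the differential ideal generated by $A$ and $S_A$ is the separant of $A$ (the partial derivative of $A$ with respect to its leader) under some ranking; it is a prime differential ideal independent of the ranking. $(\mathcal C,A)$ denotes the irreducible (plane) differential curve $\mathcal C=\mathbb V(\mathrm{sat}(A))\subset\mathbb A^2(\mathcal E)$, the set of differential zeros of $\mathrm{sat}(A)$. $\mathcal C$ is unirational if it has a generic point of the form $\mathcal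 P(u)=\big(\frac{P_1(u)}{Q_1(u)},\frac{P_2(u)}{Q_2(u)}\big)\in\mathcal F\langle u\rangle^2$, i.e. the set $\mathbb I(\mathcal P(u))$ of differential polynomials in $\mathcal F\{x,y\}$ vanishing at $\mathcal P(u)$ equals $\mathrm{sat}(A)$; such $\mathcal P(u)$ is called a differential rational parametrization of $\mathcal C$ (or of $A$). It is always assumed that $P_i,Q_i\in\mathcal F\{u\}$ and $\gcd(P_i,Q_i)=1$. The parametrization is proper if $\mathcal F\langle \frac{P_1(u)}{Q_1(u)},\frac{P_2(u)}{Q_2(u)}\rangle=\mathcal F\langle u\rangle$. For $R(u)\in\mathcal F\langle u\rangle\setminus\mathcal F$, $\mathcal P(R(u))$ denotes the result of substituting $R(u)$ for $u$ (and $R(u)^{(k)}$ for $u^{(k)}$) in $\mathcal P(u)$. *)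

theory Defs
  imports
    "HOL-Algebra.Subrings"
    "HOL-Library.Poly_Mapping"
    "HOL-Computational_Algebra.Factorial_Ring"
begin

section \<open>Ordinary differential fields and their extensions\<close>

class differential_field = field_char_0 +
  fixes der :: "'a \<Rightarrow> 'a"
  assumes der_add: "der (x + y) = der x + der y"
    and der_mult: "der (x * y) = der x * y + x * der y"

text \<open>A differential extension field of \<open>'f\<close> is a differential field \<open>'e\<close> together with
  an embedding \<open>\<iota>\<close> (injectivity and \<open>\<iota> 0 = 0\<close> follow, both types being fields).\<close>

definition differential_extension :: "('f::differential_field \<Rightarrow> 'e::differential_field) \<Rightarrow> bool" where
  "differential_extension \<iota> \<longleftrightarrow>
     \<iota> 1 = 1 \<and> (\<forall>a b. \<iota> (a + b) = \<iota> a + \<iota> b) \<and> (\<forall>a b. \<iota> (a * b) = \<iota> a * \<iota> b) \<and>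
     (\<forall>a. \<iota> (der a) = der (\<iota> a))"

definition differential_subfield :: "'e::differential_field set \<Rightarrow> bool" where
  "differential_subfield K \<longleftrightarrow>
     0 \<in> K \<and> 1 \<in> K \<and> (\<forall>a\<in>K. \<forall>b\<in>K. a + b \<in> K \<and> a * b \<in> K) \<and>
     (\<forall>a\<in>K. - a \<in> K \<and> inverse a \<in> K \<and> der a \<in> K)"

text \<open>\<open>\<F>\<langle>S\<rangle>\<close>\<close>

definition dfield_gen :: "('f::differential_field \<Rightarrow> 'e::differential_field) \<Rightarrow> 'e set \<Rightarrow> 'e set" where
  "dfield_gen \<iota> S = differential_subfield hull (range \<iota> \<union> S)"


subsection \<open>Universal extensions\<close>

definition ring_on :: "'e::differential_field set \<Rightarrow> 'e ring" where
  "ring_on K = \<lparr>carrier = K, monoid.mult = (*), one = 1, zero = 0, add = (+)\<rparr>"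

definition derivation_on :: "('a, 'm) ring_scheme \<Rightarrow> ('a \<Rightarrow> 'a) \<Rightarrow> bool" where
  "derivation_on G D \<longleftrightarrow> D \<in> carrier G \<rightarrow> carrier G \<and>
     (\<forall>x\<in>carrier G. \<forall>y\<in>carrier G.
        D (x \<oplus>\<^bsub>G\<^esub> y) = D x \<oplus>\<^bsub>G\<^esub> D y \<and>
        D (x \<otimes>\<^bsub>G\<^esub> y) = (D x \<otimes>\<^bsub>G\<^esub> y) \<oplus>\<^bsub>G\<^esub> (x \<otimes>\<^bsub>G\<^esub> D y))"

text \<open>\<open>G\<close> is generated, as a differential field with derivation \<open>D\<close>, by \<open>B\<close> and finitely many
  further elements.\<close>

definition fin_diff_generated_over ::
    "('a, 'm) ring_scheme \<Rightarrow> ('a \<Rightarrow> 'a) \<Rightarrow> 'a set \<Rightarrow> bool" where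
  "fin_diff_generated_over G D B \<longleftrightarrow>
     (\<exists>T. finite T \<and> T \<subseteq> carrier G \<and>
        (\<forall>K. subfield K G \<and> D ` K \<subseteq> K \<and> B \<union> T \<subseteq> K \<longrightarrow> K = carrier G))"

text \<open>Kolchin's definition: for every finitely generated differential extension
  \<open>\<F>\<^sub>1 = \<F>\<langle>S\<rangle>\<close> of \<open>\<F>\<close> inside \<open>\<E>\<close>, every finitely generated differential
  extension field \<open>\<G>\<close> of \<open>\<F>\<^sub>1\<close> embeds into \<open>\<E>\<close> over \<open>\<F>\<^sub>1\<close>.
  The extension \<open>\<G>\<close> is an arbitrary field structure on some set of elements of \<open>'e\<close>, unrelated
  to the field operations of \<open>'e\<close>. Taking the underlying set in \<open>'e\<close> is no restriction: in
  characteristic 0 the field \<open>\<F>\<^sub>1\<close> is infinite, so \<open>\<G>\<close> has the cardinality of \<open>\<F>\<^sub>1\<close>.\<close>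

definition universal_extension ::
    "('f::differential_field \<Rightarrow> 'e::differential_field) \<Rightarrow> bool" where
  "universal_extension \<iota> \<longleftrightarrow> differential_extension \<iota> \<and>
     (\<forall>S. finite S \<longrightarrow>
       (\<forall>(G :: 'e ring) D i.
          field G \<and> derivation_on G D \<and>
          i \<in> ring_hom (ring_on (dfield_gen \<iota> S)) G \<and>
          (\<forall>x\<in>dfield_gen \<iota> S. i (der x) = D (i x)) \<and>
          fin_diff_generated_over G D (i ` dfield_gen \<iota> S) \<longrightarrow>
          (\<exists>j. j \<in> ring_hom G (ring_on UNIV) \<and>
               (\<forall>x\<in>carrier G. j (D x) = der (j x)) \<and>
               (\<forall>x\<in>dfield_gen \<iota> S. j (i x) = x))))"


section \<open>Differential polynomials\<close>

text \<open>The variable \<open>(v, k)\<close> stands for the \<open>k\<close>-th derivative of the differential indeterminate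
  \<open>v\<close>; differential polynomials are polynomials in these variables.\<close>

type_synonym ('v, 'f) dpoly = "(('v \<times> nat) \<Rightarrow>\<^sub>0 nat) \<Rightarrow>\<^sub>0 'f"

definition dvar :: "'v \<times> nat \<Rightarrow> ('v, 'f::differential_field) dpoly" where
  "dvar w = Poly_Mapping.single (Poly_Mapping.single w 1) 1"

definition dconst :: "'f::differential_field \<Rightarrow> ('v, 'f) dpoly" where
  "dconst c = Poly_Mapping.single 0 c"

definition dvars :: "('v, 'f::differential_field) dpoly \<Rightarrow> ('v \<times> nat) set" where
  "dvars p = (\<Union>m\<in>Poly_Mapping.keys p. Poly_Mapping.keys m)"

definition partial_deriv :: "'v \<times> nat \<Rightarrow> ('v, 'f::differential_field) dpoly \<Rightarrow> ('v, 'f) dpoly" where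
  "partial_deriv w p =
     (\<Sum>m\<in>Poly_Mapping.keys p.
        Poly_Mapping.single (m - Poly_Mapping.single w 1)
          (of_nat (Poly_Mapping.lookup m w) * Poly_Mapping.lookup p m))"

definition next_deriv :: "'v \<times> nat \<Rightarrow> 'v \<times> nat" where
  "next_deriv w = (fst w, Suc (snd w))"

text \<open>The derivation extending that of \<open>'f\<close> and sending each variable to the next derivative,
  written out by the chain rule.\<close>

definition dpoly_der :: "('v, 'f::differential_field) dpoly \<Rightarrow> ('v, 'f) dpoly" where
  "dpoly_der p =
     (\<Sum>m\<in>Poly_Mapping.keys p. Poly_Mapping.single m (der (Poly_Mapping.lookup p m))) +
     (\<Sum>w\<in>dvars p. dvar (next_deriv w) * partial_deriv w p)"

definition deval ::
    "('f::differential_field \<Rightarrow> 'e::differential_field) \<Rightarrow> ('v, 'f) dpoly \<Rightarrow> ('v \<Rightarrow> 'e) \<Rightarrow> 'e" where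
  "deval \<iota> p \<eta> =
     (\<Sum>m\<in>Poly_Mapping.keys p. \<iota> (Poly_Mapping.lookup p m) *
        (\<Prod>w\<in>Poly_Mapping.keys m. ((der ^^ snd w) (\<eta> (fst w))) ^ Poly_Mapping.lookup m w))"

definition differential_ideal :: "('v, 'f::differential_field) dpoly set \<Rightarrow> bool" where
  "differential_ideal I \<longleftrightarrow>
     0 \<in> I \<and> (\<forall>p\<in>I. \<forall>q\<in>I. p + q \<in> I) \<and> (\<forall>p\<in>I. \<forall>r. r * p \<in> I) \<and> (\<forall>p\<in>I. dpoly_der p \<in> I)"


subsection \<open>Rankings and separants\<close>

definition ranking :: "('v \<times> nat) rel \<Rightarrow> bool" where
  "ranking R \<longleftrightarrow> linear_order R \<and>
     (\<forall>w. (w, next_deriv w) \<in> R) \<and>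
     (\<forall>w w'. (w, w') \<in> R \<longrightarrow> (next_deriv w, next_deriv w') \<in> R)"

definition leader :: "('v \<times> nat) rel \<Rightarrow> ('v, 'f::differential_field) dpoly \<Rightarrow> 'v \<times> nat" where
  "leader R p = (THE w. w \<in> dvars p \<and> (\<forall>w'\<in>dvars p. (w', w) \<in> R))"

definition separant :: "('v \<times> nat) rel \<Rightarrow> ('v, 'f::differential_field) dpoly \<Rightarrow> ('v, 'f) dpoly" where
  "separant R p = partial_deriv (leader R p) p"

text \<open>For irreducible \<open>p\<close> the set \<open>sat R p\<close> does not depend on the ranking \<open>R\<close>.\<close>

definition sat :: "('v \<times> nat) rel \<Rightarrow> ('v, 'f::differential_field) dpoly \<Rightarrow> ('v, 'f) dpoly set" where
  "sat R p = {f. \<exists>m. separant R p ^ m * f \<in> differential_ideal hull {p}}"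


section \<open>Plane differential curves and their parametrizations\<close>

datatype plane_var = X | Y

fun coords :: "'e \<times> 'e \<Rightarrow> plane_var \<Rightarrow> 'e" where
  "coords P X = fst P"
| "coords P Y = snd P"

definition zero_set ::
    "('f::differential_field \<Rightarrow> 'e::differential_field) \<Rightarrow> (plane_var, 'f) dpoly set \<Rightarrow> ('e \<times> 'e) set" where
  "zero_set \<iota> I = {P. \<forall>f\<in>I. deval \<iota> f (coords P) = 0}"

definition vanishing_ideal ::
    "('f::differential_field \<Rightarrow> 'e::differential_field) \<Rightarrow> 'e \<times> 'e \<Rightarrow> (plane_var, 'f) dpoly set" where
  "vanishing_ideal \<iota> P = {f. deval \<iota> f (coords P) = 0}"

definition irreducible_curve ::
    "('f::differential_field \<Rightarrow> 'e::differential_field) \<Rightarrow> (plane_var \<times> nat) rel \<Rightarrow>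
     ('e \<times> 'e) set \<Rightarrow> (plane_var, 'f) dpoly \<Rightarrow> bool" where
  "irreducible_curve \<iota> R C A \<longleftrightarrow>
     irreducible A \<and> A \<notin> range dconst \<and> C = zero_set \<iota> (sat R A)"

definition generic_point ::
    "('f::differential_field \<Rightarrow> 'e::differential_field) \<Rightarrow> (plane_var \<times> nat) rel \<Rightarrow>
     ('e \<times> 'e) set \<Rightarrow> (plane_var, 'f) dpoly \<Rightarrow> 'e \<times> 'e \<Rightarrow> bool" where
  "generic_point \<iota> R C A P \<longleftrightarrow> P \<in> C \<and> vanishing_ideal \<iota> P = sat R A"

definition diff_transcendental ::
    "('f::differential_field \<Rightarrow> 'e::differential_field) \<Rightarrow> 'e \<Rightarrow> bool" where
  "diff_transcendental \<iota> u \<longleftrightarrow>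
     (\<forall>p :: (unit, 'f) dpoly. deval \<iota> p (\<lambda>_. u) = 0 \<longrightarrow> p = 0)"

text \<open>A pair of reduced differential rational functions in one indeterminate. For \<open>u\<close>
  differentially transcendental over \<open>'f\<close>, \<open>(unit, 'f) dpoly\<close> is isomorphic to \<open>\<F>{u}\<close> via
  evaluation at \<open>u\<close>.\<close>

record (overloaded) 'f rational_pair =
  num1 :: "(unit, 'f) dpoly"
  den1 :: "(unit, 'f) dpoly"
  num2 :: "(unit, 'f) dpoly"
  den2 :: "(unit, 'f) dpoly"

text \<open>The library's \<open>coprime\<close> requires a class with division, which \<open>dpoly\<close> does not have.\<close>

definition gcd_one :: "'a::comm_semiring_1 \<Rightarrow> 'a \<Rightarrow> bool" where
  "gcd_one p q \<longleftrightarrow> (\<forall>d. d dvd p \<longrightarrow> d dvd q \<longrightarrow> d dvd 1)"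

definition reduced :: "'f::differential_field rational_pair \<Rightarrow> bool" where
  "reduced P \<longleftrightarrow> den1 P \<noteq> 0 \<and> den2 P \<noteq> 0 \<and>
     gcd_one (num1 P) (den1 P) \<and> gcd_one (num2 P) (den2 P)"

text \<open>\<open>param_at \<iota> P r\<close> is \<open>\<P>(r)\<close>, the result of replacing each \<open>der\<^sup>k u\<close> in
  \<open>\<P>(u)\<close> by \<open>der\<^sup>k r\<close>.\<close>

definition param_at ::
    "('f::differential_field \<Rightarrow> 'e::differential_field) \<Rightarrow> 'f rational_pair \<Rightarrow> 'e \<Rightarrow> 'e \<times> 'e" where
  "param_at \<iota> P r =
     (deval \<iota> (num1 P) (\<lambda>_. r) / deval \<iota> (den1 P) (\<lambda>_. r),
      deval \<iota> (num2 P) (\<lambda>_. r) / deval \<iota> (den2 P) (\<lambda>_. r))"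

definition rational_parametrization ::
    "('f::differential_field \<Rightarrow> 'e::differential_field) \<Rightarrow> (plane_var \<times> nat) rel \<Rightarrow> 'e \<Rightarrow>
     ('e \<times> 'e) set \<Rightarrow> (plane_var, 'f) dpoly \<Rightarrow> 'f rational_pair \<Rightarrow> bool" where
  "rational_parametrization \<iota> R u C A P \<longleftrightarrow>
     reduced P \<and> generic_point \<iota> R C A (param_at \<iota> P u)"

definition unirational ::
    "('f::differential_field \<Rightarrow> 'e::differential_field) \<Rightarrow> (plane_var \<times> nat) rel \<Rightarrow> 'e \<Rightarrow>
     ('e \<times> 'e) set \<Rightarrow> (plane_var, 'f) dpoly \<Rightarrow> bool" where
  "unirational \<iota> R u C A \<longleftrightarrow> (\<exists>P. rational_parametrization \<iota> R u C A P)"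

definition proper_parametrization ::
    "('f::differential_field \<Rightarrow> 'e::differential_field) \<Rightarrow> (plane_var \<times> nat) rel \<Rightarrow> 'e \<Rightarrow>
     ('e \<times> 'e) set \<Rightarrow> (plane_var, 'f) dpoly \<Rightarrow> 'f rational_pair \<Rightarrow> bool" where
  "proper_parametrization \<iota> R u C A P \<longleftrightarrow>
     rational_parametrization \<iota> R u C A P \<and>
     dfield_gen \<iota> {fst (param_at \<iota> P u), snd (param_at \<iota> P u)} = dfield_gen \<iota> {u}"

definition moebius ::
    "('f::differential_field \<Rightarrow> 'e::differential_field) \<Rightarrow> 'f \<Rightarrow> 'f \<Rightarrow> 'f \<Rightarrow> 'f \<Rightarrow> 'e \<Rightarrow> 'e" where
  "moebius \<iota> a b c d u = (\<iota> a * u + \<iota> b) / (\<iota> c * u + \<iota> d)"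

end

theory Submission
  imports Defs "HOL-Computational_Algebra.Polynomial"
begin

text \<open>
  A proper parametrization identifies the differential field of the curve with \<open>\<F>\<langle>u\<rangle>\<close>. Two proper
  parametrizations therefore differ by a differential automorphism of \<open>\<F>\<langle>u\<rangle>\<close> over \<open>\<F>\<close>, determined by
  the image \<open>r\<close> of \<open>u\<close>, so the theorem amounts to the fact that \<open>\<F>\<langle>r\<rangle> = \<F>\<langle>u\<rangle>\<close> forces
  \<open>r = (a u + b) / (c u + d)\<close> (lemma \<open>automorphism_moebius\<close>).

  This has a differential and an algebraic part. The order of a differential rational function is
  additive under composition, because the derivatives of a function of order \<open>n\<close> are linear in the
  highest derivative of \<open>u\<close> that they contain, with a nonzero leading coefficient (lemma
  \<open>derivative_leading_term\<close>). As \<open>u\<close> has order 0 in itself, \<open>r\<close> has order 0 in \<open>u\<close> and \<open>u\<close> has order 0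
  in \<open>r\<close>, that is, \<open>\<F>(r) = \<F>(u)\<close> already without derivatives (lemma \<open>same_dfield_order_zero\<close>).
  The algebraic part is that a generator of \<open>\<F>(u)\<close> is a fractional linear function of \<open>u\<close>. Writing
  \<open>r = p(u) / q(u)\<close>, the element \<open>u\<close> is a root of a polynomial over \<open>\<F>[r]\<close> whose coefficients are
  linear in \<open>r\<close>; since this root lies in \<open>\<F>(r)\<close>, the rational root theorem bounds the degrees of its
  numerator and denominator by 1 (lemma \<open>moebius_generator\<close>).

  For the converse, \<open>m(u)\<close> is again differentially transcendental for an invertible Moebius
  transformation \<open>m\<close>, by specializing at \<open>m\<^sup>-\<^sup>1(u)\<close> (lemma \<open>diff_transcendental_moebius\<close>). So
  \<open>u \<mapsto> m(u)\<close> extends to an automorphism of \<open>\<F>\<langle>u\<rangle>\<close>, under which generic points stay generic and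
  properness is preserved. The resulting functions are brought into reduced form by cancelling
  common factors until the total degree is minimal (lemma \<open>reduced_quotient\<close>).

  Isomorphisms of differential fields are represented throughout by their graphs: a pair consists of
  the values of one fraction of differential polynomials at two points that satisfy the same differential
  equations.
\<close>

section \<open>Evaluating polynomials in arbitrarily many variables\<close>

text \<open>Besides differential evaluation \<open>deval\<close>, two further evaluations occur below: they take values in
polynomials over the extension field, one of them isolating a single derivative as the polynomial
variable, the other recording the total degree. All three are instances of one ring homomorphism,
determined by a map on coefficients and an assignment of the variables.\<close>

definition monomial_value :: "('w \<Rightarrow> 'a::comm_ring_1) \<Rightarrow> ('w \<Rightarrow>\<^sub>0 nat) \<Rightarrow> 'a" where
  "monomial_value g m = (\<Prod>w\<in>Poly_Mapping.keys m. g w ^ Poly_Mapping.lookup m w)"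

definition eval_poly_mapping ::
    "('f::comm_ring_1 \<Rightarrow> 'a::comm_ring_1) \<Rightarrow> ('w \<Rightarrow> 'a) \<Rightarrow> (('w \<Rightarrow>\<^sub>0 nat) \<Rightarrow>\<^sub>0 'f) \<Rightarrow> 'a" where
  "eval_poly_mapping h g p =
     (\<Sum>m\<in>Poly_Mapping.keys p. h (Poly_Mapping.lookup p m) * monomial_value g m)"

lemma monomial_value_superset:
  assumes "finite S" "Poly_Mapping.keys m \<subseteq> S"
  shows "monomial_value g m = (\<Prod>w\<in>S. g w ^ Poly_Mapping.lookup m w)"
  unfolding monomial_value_def
  by (rule prod.mono_neutral_left) (use assms in \<open>auto simp: in_keys_iff\<close>)

lemma monomial_value_add: "monomial_value g (m + n) = monomial_value g m * monomial_value g n"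
proof -
  let ?S = "Poly_Mapping.keys m \<union> Poly_Mapping.keys n"
  have "Poly_Mapping.keys (m + n) \<subseteq> ?S" by (rule Poly_Mapping.keys_add)
  then show ?thesis
    by (simp add: monomial_value_superset[of ?S] lookup_add power_add prod.distrib)
qed

lemma poly_mapping_sum_single:
  "p = (\<Sum>m\<in>Poly_Mapping.keys p. Poly_Mapping.single m (Poly_Mapping.lookup p m))"
proof (rule poly_mapping_eqI)
  fix k
  show "Poly_Mapping.lookup p k =
        Poly_Mapping.lookup (\<Sum>m\<in>Poly_Mapping.keys p. Poly_Mapping.single m (Poly_Mapping.lookup p m)) k"
    by (auto simp: lookup_sum lookup_single when_def in_keys_iff)
qed

lemma poly_mapping_induct_single [case_names zero single sum]:
  assumes "P 0" "\<And>m c. P (Poly_Mapping.single m c)" "\<And>p q. P p \<Longrightarrow> P q \<Longrightarrow> P (p + q)"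
  shows "P (p :: 'a \<Rightarrow>\<^sub>0 'b::comm_monoid_add)"
proof -
  have "P (\<Sum>m\<in>S. Poly_Mapping.single m (f m))" if "finite S" for S and f :: "'a \<Rightarrow> 'b"
    using that by induction (use assms in auto)
  from this[of "Poly_Mapping.keys p" "Poly_Mapping.lookup p"] show ?thesis
    using poly_mapping_sum_single[of p] by simp
qed

locale coefficient_hom =
  fixes h :: "'f::comm_ring_1 \<Rightarrow> 'a::comm_ring_1"
  assumes hom_one: "h 1 = 1"
    and hom_add: "h (a + b) = h a + h b"
    and hom_mult: "h (a * b) = h a * h b"
begin

lemma hom_zero: "h 0 = 0"
  using hom_add[of 0 0] by simp

lemma hom_uminus: "h (- a) = - h a"
  using hom_add[of a "- a"] by (simp add: hom_zero eq_neg_iff_add_eq_0 add.commute)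

lemma hom_diff: "h (a - b) = h a - h b"
  using hom_add[of a "- b"] by (simp add: hom_uminus)

lemma eval_superset:
  assumes "finite S" "Poly_Mapping.keys p \<subseteq> S"
  shows "eval_poly_mapping h g p = (\<Sum>m\<in>S. h (Poly_Mapping.lookup p m) * monomial_value g m)"
  unfolding eval_poly_mapping_def
  by (rule sum.mono_neutral_left) (use assms in \<open>auto simp: in_keys_iff hom_zero\<close>)

lemma eval_zero [simp]: "eval_poly_mapping h g 0 = 0"
  by (simp add: eval_poly_mapping_def)

lemma eval_single [simp]: "eval_poly_mapping h g (Poly_Mapping.single m c) = h c * monomial_value g m"
  by (simp add: eval_superset[of "{m}"])

lemma eval_add [simp]: "eval_poly_mapping h g (p + q) = eval_poly_mapping h g p + eval_poly_mapping h g q"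
proof -
  let ?S = "Poly_Mapping.keys p \<union> Poly_Mapping.keys q"
  have "Poly_Mapping.keys (p + q) \<subseteq> ?S" by (rule Poly_Mapping.keys_add)
  then show ?thesis
    by (simp add: eval_superset[of ?S] lookup_add hom_add algebra_simps sum.distrib)
qed

lemma eval_sum: "eval_poly_mapping h g (\<Sum>i\<in>S. f i) = (\<Sum>i\<in>S. eval_poly_mapping h g (f i))"
  by (induction S rule: infinite_finite_induct) auto

lemma eval_mult [simp]: "eval_poly_mapping h g (p * q) = eval_poly_mapping h g p * eval_poly_mapping h g q"
proof (induction p rule: poly_mapping_induct_single)
  case (single m c)
  show ?case
    by (induction q rule: poly_mapping_induct_single)
      (simp_all add: mult_single hom_mult monomial_value_add algebra_simps)
qed (simp_all add: algebra_simps)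

end

text \<open>Differential polynomials are generated as a ring by constants and derivatives of the indeterminates.
Statements about the homomorphism \<open>deval\<close> are proved along this rule, which avoids computing with
coefficients of products.\<close>

lemma dpoly_induct [case_names const var add mult]:
  fixes p :: "('v, 'f::differential_field) dpoly"
  assumes const: "\<And>c. P (dconst c)" and var: "\<And>w. P (dvar w)"
    and add: "\<And>p q. P p \<Longrightarrow> P q \<Longrightarrow> P (p + q)" and mult: "\<And>p q. P p \<Longrightarrow> P q \<Longrightarrow> P (p * q)"
  shows "P p"
proof (induction p rule: poly_mapping_induct_single)
  case zero
  show ?case using const[of 0] by (simp add: dconst_def)
next
  case (single m c)
  have power: "P (Poly_Mapping.single (Poly_Mapping.single w k) 1)" for w k
  proof (induction k)
    case 0
    show ?case using const[of 1] by (simp add: dconst_def)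
  next
    case (Suc k)
    have "Poly_Mapping.single (Poly_Mapping.single w (Suc k)) (1::'f) =
          dvar w * Poly_Mapping.single (Poly_Mapping.single w k) 1"
      by (simp add: dvar_def mult_single flip: single_add)
    then show ?case using mult[OF var Suc] by metis
  qed
  have monomial: "P (Poly_Mapping.single m 1)"
  proof (induction m rule: poly_mapping_induct_single)
    case zero
    show ?case using const[of 1] by (simp add: dconst_def)
  next
    case (sum m n)
    then show ?case using mult[of "Poly_Mapping.single m 1" "Poly_Mapping.single n 1"]
      by (simp add: mult_single)
  qed (rule power)
  show ?case using mult[OF const[of c] monomial] by (simp add: dconst_def mult_single)
qed (rule add)

section \<open>Differential fields\<close>

lemma der_zero [simp]: "der (0::'a::differential_field) = 0"
  using der_add[of 0 "0::'a"] by simp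

lemma der_one [simp]: "der (1::'a::differential_field) = 0"
  using der_mult[of 1 "1::'a"] by simp

lemma der_divide:
  fixes x y :: "'a::differential_field"
  assumes "y \<noteq> 0"
  shows "der (x / y) = (der x * y - x * der y) / (y * y)"
proof -
  have "der x = der (x / y * y)" using assms by simp
  also have "\<dots> = der (x / y) * y + x / y * der y" by (rule der_mult)
  finally show ?thesis using assms by (simp add: field_simps)
qed

lemma differential_subfield_dfield_gen: "differential_subfield (dfield_gen \<iota> S)"
  unfolding dfield_gen_def
  by (rule hull_in) (unfold differential_subfield_def, blast)

lemma range_subset_dfield_gen: "range \<iota> \<subseteq> dfield_gen \<iota> S"
  unfolding dfield_gen_def using hull_subset[of "range \<iota> \<union> S" differential_subfield] by blast

lemma gen_subset_dfield_gen: "S \<subseteq> dfield_gen \<iota> S"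
  unfolding dfield_gen_def using hull_subset[of "range \<iota> \<union> S" differential_subfield] by blast

lemma dfield_gen_least:
  assumes "differential_subfield K" "range \<iota> \<subseteq> K" "S \<subseteq> K"
  shows "dfield_gen \<iota> S \<subseteq> K"
  unfolding dfield_gen_def by (rule hull_minimal) (use assms in auto)

lemma differential_subfieldD:
  assumes "differential_subfield K"
  shows "0 \<in> K" "1 \<in> K" "a \<in> K \<Longrightarrow> b \<in> K \<Longrightarrow> a + b \<in> K" "a \<in> K \<Longrightarrow> b \<in> K \<Longrightarrow> a * b \<in> K"
    "a \<in> K \<Longrightarrow> - a \<in> K" "a \<in> K \<Longrightarrow> inverse a \<in> K" "a \<in> K \<Longrightarrow> der a \<in> K"
    "a \<in> K \<Longrightarrow> b \<in> K \<Longrightarrow> a / b \<in> K"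
  using assms unfolding differential_subfield_def by (auto simp: divide_inverse)

locale diff_extension =
  fixes \<iota> :: "'f::differential_field \<Rightarrow> 'e::differential_field"
  assumes ext: "differential_extension \<iota>"
begin

sublocale coefficient_hom \<iota>
  using ext by unfold_locales (auto simp: differential_extension_def)

lemma \<iota>_der: "\<iota> (der a) = der (\<iota> a)"
  using ext by (simp add: differential_extension_def)

lemma \<iota>_eq_0_iff [simp]: "\<iota> a = 0 \<longleftrightarrow> a = 0"
proof
  assume "\<iota> a = 0"
  show "a = 0"
  proof (rule ccontr)
    assume "a \<noteq> 0"
    then have "\<iota> (a * inverse a) = 1" by (simp add: hom_one)
    then show False using \<open>\<iota> a = 0\<close> by (simp add: hom_mult)
  qed
qed (simp add: hom_zero)

lemma \<iota>_inverse: "\<iota> (inverse a) = inverse (\<iota> a)"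
proof (cases "a = 0")
  case False
  then have "\<iota> a * \<iota> (inverse a) = 1" by (simp add: hom_one flip: hom_mult)
  then show ?thesis by (simp add: inverse_unique)
qed (simp add: hom_zero)

lemma \<iota>_divide: "\<iota> (a / b) = \<iota> a / \<iota> b"
  by (simp add: divide_inverse hom_mult \<iota>_inverse)

lemma deval_eq: "deval \<iota> p \<eta> = eval_poly_mapping \<iota> (\<lambda>w. (der ^^ snd w) (\<eta> (fst w))) p"
  by (simp add: deval_def eval_poly_mapping_def monomial_value_def)

lemma deval_add [simp]: "deval \<iota> (p + q) \<eta> = deval \<iota> p \<eta> + deval \<iota> q \<eta>"
  by (simp add: deval_eq)

lemma deval_mult [simp]: "deval \<iota> (p * q) \<eta> = deval \<iota> p \<eta> * deval \<iota> q \<eta>"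
  by (simp add: deval_eq)

lemma deval_const [simp]: "deval \<iota> (dconst c) \<eta> = \<iota> c"
  by (simp add: deval_eq dconst_def monomial_value_def)

lemma deval_var [simp]: "deval \<iota> (dvar w) \<eta> = (der ^^ snd w) (\<eta> (fst w))"
  by (simp add: deval_eq dvar_def monomial_value_def hom_one)

lemma deval_0 [simp]: "deval \<iota> 0 \<eta> = 0"
  by (simp add: deval_eq)

lemma deval_1 [simp]: "deval \<iota> 1 \<eta> = 1"
  using deval_const[of 1] by (simp add: dconst_def hom_one)

lemma deval_uminus [simp]: "deval \<iota> (- p) \<eta> = - deval \<iota> p \<eta>"
  using deval_add[of p "- p" \<eta>] by (simp add: eq_neg_iff_add_eq_0 add.commute del: deval_add)

lemma deval_diff [simp]: "deval \<iota> (p - q) \<eta> = deval \<iota> p \<eta> - deval \<iota> q \<eta>"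
  using deval_add[of p "- q" \<eta>] by simp

lemma deval_power [simp]: "deval \<iota> (p ^ n) \<eta> = deval \<iota> p \<eta> ^ n"
  by (induction n) auto

text \<open>One differential polynomial serves all points \<open>\<eta>\<close> simultaneously. This uniformity is what
makes differentiation compatible with specialization: the same formula gives the derivative at
two different points. Its existence is all that is needed, so the explicit chain rule is avoided.\<close>

lemma deval_derivative:
  obtains q where "\<And>\<eta>. deval \<iota> q \<eta> = der (deval \<iota> p \<eta>)"
proof -
  have "\<exists>q. \<forall>\<eta>. deval \<iota> q \<eta> = der (deval \<iota> p \<eta>)"
  proof (induction p rule: dpoly_induct)
    case (const c)
    show ?case by (rule exI[of _ "dconst (der c)"]) (simp add: \<iota>_der)
  next
    case (var w)
    show ?case by (rule exI[of _ "dvar (next_deriv w)"]) (simp add: next_deriv_def)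
  next
    case (add p q)
    then obtain p' q' where "\<forall>\<eta>. deval \<iota> p' \<eta> = der (deval \<iota> p \<eta>)" "\<forall>\<eta>. deval \<iota> q' \<eta> = der (deval \<iota> q \<eta>)"
      by blast
    then show ?case by (intro exI[of _ "p' + q'"]) (simp add: der_add)
  next
    case (mult p q)
    then obtain p' q' where "\<forall>\<eta>. deval \<iota> p' \<eta> = der (deval \<iota> p \<eta>)" "\<forall>\<eta>. deval \<iota> q' \<eta> = der (deval \<iota> q \<eta>)"
      by blast
    then show ?case by (intro exI[of _ "p' * q + p * q'"]) (simp add: der_mult)
  qed
  then show ?thesis using that by blast
qed

lemma deval_in_dfield:
  assumes K: "differential_subfield K" "range \<iota> \<subseteq> K" "range \<eta> \<subseteq> K"
  shows "deval \<iota> p \<eta> \<in> K"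
proof (induction p rule: dpoly_induct)
  case (var w)
  have "(der ^^ k) (\<eta> (fst w)) \<in> K" for k
    by (induction k) (use K in \<open>auto intro: differential_subfieldD\<close>)
  then show ?case by simp
qed (use K in \<open>auto intro: differential_subfieldD\<close>)

section \<open>Specializations of generic points\<close>

text \<open>The graph of the specialization \<open>\<eta> \<mapsto> \<zeta>\<close> on quotients \<open>p(\<eta>) / q(\<eta>)\<close>. It is kept as a relation because it
becomes a function, and then an isomorphism of differential fields, only if \<open>\<eta>\<close> and \<open>\<zeta>\<close> satisfy the
same differential equations; see the locale \<open>same_vanishing\<close>.\<close>

definition correspond :: "('v \<Rightarrow> 'e) \<Rightarrow> ('v \<Rightarrow> 'e) \<Rightarrow> 'e \<Rightarrow> 'e \<Rightarrow> bool" where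
  "correspond \<eta> \<zeta> a b \<longleftrightarrow> (\<exists>p q. deval \<iota> q \<eta> \<noteq> 0 \<and> deval \<iota> q \<zeta> \<noteq> 0 \<and>
     a = deval \<iota> p \<eta> / deval \<iota> q \<eta> \<and> b = deval \<iota> p \<zeta> / deval \<iota> q \<zeta>)"

lemma correspondI:
  "deval \<iota> q \<eta> \<noteq> 0 \<Longrightarrow> deval \<iota> q \<zeta> \<noteq> 0 \<Longrightarrow> a = deval \<iota> p \<eta> / deval \<iota> q \<eta> \<Longrightarrow>
   b = deval \<iota> p \<zeta> / deval \<iota> q \<zeta> \<Longrightarrow> correspond \<eta> \<zeta> a b"
  unfolding correspond_def by blast

lemma correspond_deval: "correspond \<eta> \<zeta> (deval \<iota> p \<eta>) (deval \<iota> p \<zeta>)"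
  by (rule correspondI[of 1 _ _ _ p]) auto

lemma correspond_const: "correspond \<eta> \<zeta> (\<iota> c) (\<iota> c)"
  using correspond_deval[of _ _ "dconst c"] by simp

lemma correspond_gen: "correspond \<eta> \<zeta> (\<eta> v) (\<zeta> v)"
  using correspond_deval[of _ _ "dvar (v, 0)"] by simp

lemma correspond_add:
  assumes "correspond \<eta> \<zeta> a b" "correspond \<eta> \<zeta> a' b'"
  shows "correspond \<eta> \<zeta> (a + a') (b + b')"
proof -
  from assms obtain p q p' q' where *: "deval \<iota> q \<eta> \<noteq> 0" "deval \<iota> q \<zeta> \<noteq> 0" "deval \<iota> q' \<eta> \<noteq> 0" "deval \<iota> q' \<zeta> \<noteq> 0"
    "a = deval \<iota> p \<eta> / deval \<iota> q \<eta>" "b = deval \<iota> p \<zeta> / deval \<iota> q \<zeta>"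
    "a' = deval \<iota> p' \<eta> / deval \<iota> q' \<eta>" "b' = deval \<iota> p' \<zeta> / deval \<iota> q' \<zeta>"
    unfolding correspond_def by metis
  show ?thesis
    by (rule correspondI[of "q * q'" _ _ _ "p * q' + p' * q"]) (use * in \<open>auto simp: add_frac_eq\<close>)
qed

lemma correspond_mult:
  assumes "correspond \<eta> \<zeta> a b" "correspond \<eta> \<zeta> a' b'"
  shows "correspond \<eta> \<zeta> (a * a') (b * b')"
proof -
  from assms obtain p q p' q' where *: "deval \<iota> q \<eta> \<noteq> 0" "deval \<iota> q \<zeta> \<noteq> 0" "deval \<iota> q' \<eta> \<noteq> 0" "deval \<iota> q' \<zeta> \<noteq> 0"
    "a = deval \<iota> p \<eta> / deval \<iota> q \<eta>" "b = deval \<iota> p \<zeta> / deval \<iota> q \<zeta>"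
    "a' = deval \<iota> p' \<eta> / deval \<iota> q' \<eta>" "b' = deval \<iota> p' \<zeta> / deval \<iota> q' \<zeta>"
    unfolding correspond_def by metis
  show ?thesis
    by (rule correspondI[of "q * q'" _ _ _ "p * p'"]) (use * in auto)
qed

lemma correspond_uminus:
  assumes "correspond \<eta> \<zeta> a b"
  shows "correspond \<eta> \<zeta> (- a) (- b)"
  using correspond_mult[OF correspond_const[of _ _ "-1"] assms] by (simp add: hom_uminus hom_one)

lemma correspond_der:
  assumes "correspond \<eta> \<zeta> a b"
  shows "correspond \<eta> \<zeta> (der a) (der b)"
proof -
  from assms obtain p q where *: "deval \<iota> q \<eta> \<noteq> 0" "deval \<iota> q \<zeta> \<noteq> 0"
    "a = deval \<iota> p \<eta> / deval \<iota> q \<eta>" "b = deval \<iota> p \<zeta> / deval \<iota> q \<zeta>"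
    unfolding correspond_def by metis
  obtain p' where p': "\<And>\<eta>. deval \<iota> p' \<eta> = der (deval \<iota> p \<eta>)" using deval_derivative by blast
  obtain q' where q': "\<And>\<eta>. deval \<iota> q' \<eta> = der (deval \<iota> q \<eta>)" using deval_derivative by blast
  show ?thesis
    by (rule correspondI[of "q * q" _ _ _ "p' * q - p * q'"]) (use * in \<open>auto simp: p' q' der_divide\<close>)
qed

lemma correspond_sym: "correspond \<eta> \<zeta> a b \<Longrightarrow> correspond \<zeta> \<eta> b a"
  unfolding correspond_def by blast

end

locale same_vanishing = diff_extension \<iota>
  for \<iota> :: "'f::differential_field \<Rightarrow> 'e::differential_field" +
  fixes \<eta> \<zeta> :: "'v \<Rightarrow> 'e"
  assumes vanish_iff: "deval \<iota> p \<eta> = 0 \<longleftrightarrow> deval \<iota> p \<zeta> = 0"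
begin

text \<open>Two fractions agree at \<open>\<eta>\<close> iff the cross difference of their numerators and denominators vanishes
there, a polynomial condition, which therefore holds at \<open>\<zeta>\<close> as well.\<close>

lemma correspond_unique:
  assumes "correspond \<eta> \<zeta> a b" "correspond \<eta> \<zeta> a b'"
  shows "b = b'"
proof -
  from assms obtain p q p' q' where *: "deval \<iota> q \<eta> \<noteq> 0" "deval \<iota> q \<zeta> \<noteq> 0" "deval \<iota> q' \<eta> \<noteq> 0" "deval \<iota> q' \<zeta> \<noteq> 0"
    "a = deval \<iota> p \<eta> / deval \<iota> q \<eta>" "b = deval \<iota> p \<zeta> / deval \<iota> q \<zeta>"
    "a = deval \<iota> p' \<eta> / deval \<iota> q' \<eta>" "b' = deval \<iota> p' \<zeta> / deval \<iota> q' \<zeta>"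
    unfolding correspond_def by metis
  have "deval \<iota> (p * q' - p' * q) \<eta> = 0" using * by (simp add: frac_eq_eq)
  then have "deval \<iota> (p * q' - p' * q) \<zeta> = 0" by (simp only: vanish_iff)
  then show ?thesis using * by (simp add: frac_eq_eq)
qed

lemma correspond_0_iff:
  assumes "correspond \<eta> \<zeta> a b"
  shows "a = 0 \<longleftrightarrow> b = 0"
  using assms unfolding correspond_def by (metis divide_eq_0_iff vanish_iff)

lemma correspond_inverse:
  assumes "correspond \<eta> \<zeta> a b"
  shows "correspond \<eta> \<zeta> (inverse a) (inverse b)"
proof (cases "a = 0")
  case True
  then have "b = 0" using correspond_0_iff[OF assms] by blast
  then show ?thesis using assms True by simp
next
  case False
  from assms obtain p q where *: "deval \<iota> q \<eta> \<noteq> 0" "deval \<iota> q \<zeta> \<noteq> 0"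
    "a = deval \<iota> p \<eta> / deval \<iota> q \<eta>" "b = deval \<iota> p \<zeta> / deval \<iota> q \<zeta>"
    unfolding correspond_def by metis
  have "deval \<iota> p \<eta> \<noteq> 0" using False *(3) by auto
  moreover from this have "deval \<iota> p \<zeta> \<noteq> 0" by (simp add: vanish_iff)
  ultimately show ?thesis
    by (intro correspondI[of p \<eta> \<zeta> _ q]) (simp_all add: *(3,4))
qed

lemma correspond_divide:
  assumes "correspond \<eta> \<zeta> a b" "correspond \<eta> \<zeta> a' b'"
  shows "correspond \<eta> \<zeta> (a / a') (b / b')"
  using correspond_mult[OF assms(1) correspond_inverse[OF assms(2)]] by (simp add: divide_inverse)

text \<open>The isomorphism commutes with substitution into differential polynomials, and by
\<open>correspond_divide\<close> into fractions of them: it maps \<open>\<P>(u)\<close> to \<open>\<P>(r)\<close> if it maps \<open>u\<close> to \<open>r\<close>.\<close>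

lemma correspond_subst:
  assumes "\<And>v. correspond \<eta> \<zeta> (\<sigma> v) (\<tau> v)"
  shows "correspond \<eta> \<zeta> (deval \<iota> p \<sigma>) (deval \<iota> p \<tau>)"
proof (induction p rule: dpoly_induct)
  case (var w)
  have "correspond \<eta> \<zeta> ((der ^^ k) (\<sigma> (fst w))) ((der ^^ k) (\<tau> (fst w)))" for k
    by (induction k) (auto intro: assms correspond_der)
  then show ?case by simp
qed (auto intro: correspond_const correspond_add correspond_mult)

text \<open>The quotients already form a differential field, by the quotient rule, so the isomorphism is
defined on all of \<open>\<F>\<langle>\<eta>\<rangle>\<close>.\<close>

lemma correspond_domain: "{a. \<exists>b. correspond \<eta> \<zeta> a b} = dfield_gen \<iota> (range \<eta>)"
proof
  have "deval \<iota> p \<eta> / deval \<iota> q \<eta> \<in> dfield_gen \<iota> (range \<eta>)" for p q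
    by (intro differential_subfieldD(8)[OF differential_subfield_dfield_gen] deval_in_dfield
        differential_subfield_dfield_gen range_subset_dfield_gen gen_subset_dfield_gen)
  then show "{a. \<exists>b. correspond \<eta> \<zeta> a b} \<subseteq> dfield_gen \<iota> (range \<eta>)"
    unfolding correspond_def by blast
  have "correspond \<eta> \<zeta> 0 0" "correspond \<eta> \<zeta> 1 1"
    using correspond_const[of \<eta> \<zeta> 0] correspond_const[of \<eta> \<zeta> 1] by (simp_all only: hom_zero hom_one)
  then have "differential_subfield {a. \<exists>b. correspond \<eta> \<zeta> a b}"
    unfolding differential_subfield_def mem_Collect_eq
    by (intro conjI ballI) (auto intro: correspond_add correspond_mult correspond_uminus correspond_inverse correspond_der)
  then show "dfield_gen \<iota> (range \<eta>) \<subseteq> {a. \<exists>b. correspond \<eta> \<zeta> a b}"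
    by (rule dfield_gen_least) (auto intro: correspond_const correspond_gen)
qed

end

lemma (in diff_extension) dfield_gen_quotient:
  assumes "a \<in> dfield_gen \<iota> (range \<eta>)"
  obtains p q where "deval \<iota> q \<eta> \<noteq> 0" "a = deval \<iota> p \<eta> / deval \<iota> q \<eta>"
proof -
  interpret same_vanishing \<iota> \<eta> \<eta> by unfold_locales auto
  have "\<exists>b. correspond \<eta> \<eta> a b" using assms unfolding correspond_domain[symmetric] by blast
  then show ?thesis using that unfolding correspond_def by blast
qed

section \<open>Simple transcendental extensions\<close>

definition is_subfield :: "'a::field set \<Rightarrow> bool" where
  "is_subfield K \<longleftrightarrow> 0 \<in> K \<and> 1 \<in> K \<and> (\<forall>a\<in>K. \<forall>b\<in>K. a + b \<in> K \<and> a * b \<in> K) \<and>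
     (\<forall>a\<in>K. - a \<in> K \<and> inverse a \<in> K)"

lemma is_subfieldD:
  assumes "is_subfield K"
  shows "0 \<in> K" "1 \<in> K" "a \<in> K \<Longrightarrow> b \<in> K \<Longrightarrow> a + b \<in> K" "a \<in> K \<Longrightarrow> b \<in> K \<Longrightarrow> a * b \<in> K"
    "a \<in> K \<Longrightarrow> - a \<in> K" "a \<in> K \<Longrightarrow> inverse a \<in> K" "a \<in> K \<Longrightarrow> b \<in> K \<Longrightarrow> a - b \<in> K"
    "a \<in> K \<Longrightarrow> b \<in> K \<Longrightarrow> a / b \<in> K"
  using assms unfolding is_subfield_def
  by (auto simp: divide_inverse) (metis uminus_add_conv_diff add.commute)

lemma is_subfield_sum: "is_subfield K \<Longrightarrow> (\<And>i. i \<in> S \<Longrightarrow> f i \<in> K) \<Longrightarrow> sum f S \<in> K"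
  by (induction S rule: infinite_finite_induct) (auto intro: is_subfieldD)

lemma is_subfield_of_nat: "is_subfield K \<Longrightarrow> of_nat n \<in> K"
  by (induction n) (auto intro: is_subfieldD)

text \<open>Subfields are handled as sets inside one ambient field; a polynomial over the subfield is one over the
ambient field whose coefficients happen to lie in the subfield.\<close>

definition poly_over :: "'a::field set \<Rightarrow> 'a poly \<Rightarrow> bool" where
  "poly_over K p \<longleftrightarrow> (\<forall>i. coeff p i \<in> K)"

lemma poly_over_pCons [simp]: "poly_over K (pCons a p) \<longleftrightarrow> a \<in> K \<and> poly_over K p"
  unfolding poly_over_def by (metis coeff_pCons_0 coeff_pCons_Suc not0_implies_Suc)

lemma poly_over_closed:
  assumes "is_subfield K"
  shows "poly_over K 0" "poly_over K 1" "poly_over K p \<Longrightarrow> poly_over K q \<Longrightarrow> poly_over K (p + q)"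
    "poly_over K p \<Longrightarrow> poly_over K q \<Longrightarrow> poly_over K (p * q)"
    "poly_over K p \<Longrightarrow> poly_over K (- p)" "poly_over K p \<Longrightarrow> poly_over K (pderiv p)"
  using is_subfieldD[OF assms] is_subfield_of_nat[OF assms]
  unfolding poly_over_def
  by (auto simp: coeff_mult coeff_pderiv coeff_1 simp del: of_nat_Suc intro!: is_subfield_sum[OF assms])

lemma poly_in_subfield: "is_subfield L \<Longrightarrow> x \<in> L \<Longrightarrow> poly_over L p \<Longrightarrow> poly p x \<in> L"
  by (induction p) (auto intro: is_subfieldD)

definition transcendental_over :: "'a::field set \<Rightarrow> 'a \<Rightarrow> bool" where
  "transcendental_over K x \<longleftrightarrow> (\<forall>p. poly_over K p \<longrightarrow> poly p x = 0 \<longrightarrow> p = 0)"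

lemma transcendental_over_not_in:
  assumes "is_subfield K" "transcendental_over K x"
  shows "x \<notin> K"
proof
  assume "x \<in> K"
  then have "poly_over K [:- x, 1:]" using assms by (auto intro: is_subfieldD poly_over_closed)
  then have "[:- x, 1:] = 0"
    using assms(2) unfolding transcendental_over_def by (elim allE[of _ "[:- x, 1:]"]) simp
  then show False by simp
qed

definition adjoin :: "'a::field set \<Rightarrow> 'a \<Rightarrow> 'a set" where
  "adjoin K x = {poly p x / poly q x | p q. poly_over K p \<and> poly_over K q \<and> poly q x \<noteq> 0}"

lemma adjoinI: "poly_over K p \<Longrightarrow> poly_over K q \<Longrightarrow> poly q x \<noteq> 0 \<Longrightarrow> s = poly p x / poly q x \<Longrightarrow> s \<in> adjoin K x"
  unfolding adjoin_def by blast

lemma poly_in_adjoin: "is_subfield K \<Longrightarrow> poly_over K p \<Longrightarrow> poly p x \<in> adjoin K x"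
  by (rule adjoinI[of _ p 1]) (auto intro: poly_over_closed)

lemma subset_adjoin: "is_subfield K \<Longrightarrow> K \<subseteq> adjoin K x"
  using poly_in_adjoin[of K "[:_:]" x] by (auto simp: poly_over_closed)

lemma self_in_adjoin: "is_subfield K \<Longrightarrow> x \<in> adjoin K x"
  using poly_in_adjoin[of K "[:0, 1:]" x] by (auto simp: poly_over_closed is_subfieldD)

lemma adjoin_least:
  assumes "is_subfield L" "K \<subseteq> L" "x \<in> L"
  shows "adjoin K x \<subseteq> L"
proof -
  have "poly p x \<in> L" if "poly_over K p" for p
    by (rule poly_in_subfield) (use assms that in \<open>auto simp: poly_over_def\<close>)
  then show ?thesis using is_subfieldD(8)[OF assms(1)] by (auto simp: adjoin_def)
qed

lemma is_subfield_adjoin: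
  assumes K: "is_subfield K"
  shows "is_subfield (adjoin K x)"
proof -
  note cl = poly_over_closed[OF K] is_subfieldD[OF K]
  have "a + b \<in> adjoin K x \<and> a * b \<in> adjoin K x" if "a \<in> adjoin K x" "b \<in> adjoin K x" for a b
  proof -
    from that obtain p q p' q' where *: "poly_over K p" "poly_over K q" "poly q x \<noteq> 0" "a = poly p x / poly q x"
      "poly_over K p'" "poly_over K q'" "poly q' x \<noteq> 0" "b = poly p' x / poly q' x"
      unfolding adjoin_def by blast
    show ?thesis
    proof
      show "a + b \<in> adjoin K x"
        by (rule adjoinI[of _ "p * q' + p' * q" "q * q'"]) (use * cl in \<open>auto simp: add_frac_eq\<close>)
      show "a * b \<in> adjoin K x"
        by (rule adjoinI[of _ "p * p'" "q * q'"]) (use * cl in auto)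
    qed
  qed
  moreover have "- a \<in> adjoin K x \<and> inverse a \<in> adjoin K x" if "a \<in> adjoin K x" for a
  proof -
    from that obtain p q where *: "poly_over K p" "poly_over K q" "poly q x \<noteq> 0" "a = poly p x / poly q x"
      unfolding adjoin_def by blast
    have "- a \<in> adjoin K x"
      by (rule adjoinI[of _ "- p" q]) (use * cl in auto)
    moreover have "inverse a \<in> adjoin K x" if "a \<noteq> 0"
      by (rule adjoinI[of _ q p]) (use * cl that in auto)
    moreover have "0 \<in> adjoin K x" using subset_adjoin[OF K] cl by blast
    ultimately show ?thesis by (cases "a = 0") auto
  qed
  moreover have "0 \<in> adjoin K x" "1 \<in> adjoin K x" using subset_adjoin[OF K] cl by auto
  ultimately show ?thesis unfolding is_subfield_def by blast
qed

lemma der_poly: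
  fixes p :: "'a::differential_field poly"
  shows "der (poly p x) = poly (map_poly der p) x + poly (pderiv p) x * der x"
  by (induction p) (simp_all add: der_add der_mult pderiv_pCons map_poly_pCons algebra_simps)

text \<open>Writing \<open>s = p(x) / q(x)\<close>, the coefficient of \<open>der x\<close> in \<open>der s\<close> is the formal derivative of the
rational function \<open>p / q\<close> at \<open>x\<close>. It does not vanish for non-constant \<open>p / q\<close>, because the
characteristic is 0. Choosing the degree of \<open>q\<close> minimal replaces the assumption that \<open>p\<close> and \<open>q\<close> are
coprime: if \<open>p' q = p q'\<close> with \<open>q' \<noteq> 0\<close>, then \<open>s = p' / q'\<close> has a denominator of smaller degree.\<close>

lemma adjoin_derivation:
  fixes x :: "'a::differential_field"
  assumes K: "is_subfield K" and derK: "der ` K \<subseteq> adjoin K x" and x: "transcendental_over K x"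
    and s: "s \<in> adjoin K x" "s \<notin> K"
  obtains a b where "a \<in> adjoin K x" "b \<in> adjoin K x" "a \<noteq> 0" "der s = a * der x + b"
proof -
  let ?M = "adjoin K x"
  let ?den = "\<lambda>q. \<exists>p. poly_over K p \<and> poly_over K q \<and> poly q x \<noteq> 0 \<and> s = poly p x / poly q x"
  note M = is_subfieldD[OF is_subfield_adjoin[OF K, of x]] and cl = poly_over_closed[OF K]
  have "\<exists>q. ?den q" using s by (auto simp: adjoin_def)
  then obtain q where "?den q" and min: "\<And>q'. ?den q' \<Longrightarrow> degree q \<le> degree q'"
    using ex_has_least_nat[of ?den _ degree] by blast
  then obtain p where p: "poly_over K p" and q: "poly_over K q" "poly q x \<noteq> 0"
    and s_eq: "s = poly p x / poly q x" by blast
  have coeffs: "poly (map_poly der f) x \<in> ?M" if "poly_over K f" for f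
    by (rule poly_in_subfield[OF is_subfield_adjoin[OF K]])
      (use that derK in \<open>auto simp: self_in_adjoin[OF K] poly_over_def coeff_map_poly\<close>)
  note in_M = coeffs[OF p] coeffs[OF q(1)] poly_in_adjoin[OF K p, of x] poly_in_adjoin[OF K q(1), of x]
    poly_in_adjoin[OF K cl(6)[OF p], of x] poly_in_adjoin[OF K cl(6)[OF q(1)], of x]
  define a where "a = (poly (pderiv p) x * poly q x - poly p x * poly (pderiv q) x) / (poly q x * poly q x)"
  define b where "b = (poly (map_poly der p) x * poly q x - poly p x * poly (map_poly der q) x) / (poly q x * poly q x)"
  have "der s = a * der x + b"
    using q(2) unfolding s_eq der_divide[OF q(2)] der_poly a_def b_def
    by (simp add: field_simps)
  moreover have "a \<noteq> 0"
  proof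
    assume "a = 0"
    then have eq: "poly (pderiv p) x * poly q x = poly p x * poly (pderiv q) x"
      using q(2) by (simp add: a_def)
    have "pderiv q = 0"
    proof (rule ccontr)
      assume q': "pderiv q \<noteq> 0"
      then have nz: "poly (pderiv q) x \<noteq> 0" using x cl(6)[OF q(1)] unfolding transcendental_over_def by blast
      then have "s = poly (pderiv p) x / poly (pderiv q) x" using eq q(2) by (simp add: s_eq frac_eq_eq)
      then have "degree q \<le> degree (pderiv q)" using cl(6) p q(1) nz by (intro min) blast
      then show False using q' by (simp add: degree_pderiv pderiv_eq_0_iff)
    qed
    then have "poly (pderiv p) x = 0" using eq q(2) by simp
    then have "pderiv p = 0" using x cl(6)[OF p] unfolding transcendental_over_def by blast
    then obtain c d where "p = [:c:]" "q = [:d:]" using \<open>pderiv q = 0\<close> by (metis pderiv_eq_0_iff degree_eq_zeroE)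
    then show False using s(2) p q(1) is_subfieldD(8)[OF K] by (auto simp: s_eq)
  qed
  moreover have "a \<in> ?M" "b \<in> ?M" unfolding a_def b_def by (intro M in_M)+
  ultimately show ?thesis using that by blast
qed

section \<open>The order of a differential rational function\<close>

context diff_extension
begin

lemma is_subfield_range: "is_subfield (range \<iota>)"
  unfolding is_subfield_def
  by (auto simp flip: hom_add hom_mult hom_uminus \<iota>_inverse intro: range_eqI[of 0 \<iota> 0] range_eqI[of 1 \<iota> 1] simp: hom_zero hom_one)

text \<open>\<open>tower u n\<close> is the field \<open>\<F>(u, u', \<dots>, u\<^sup>(\<^sup>n\<^sup>-\<^sup>1\<^sup>))\<close> of differential rational functions in \<open>u\<close> that
  involve only derivatives of order less than \<open>n\<close>.\<close>

primrec tower :: "'e \<Rightarrow> nat \<Rightarrow> 'e set" where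
  "tower u 0 = range \<iota>"
| "tower u (Suc n) = adjoin (tower u n) ((der ^^ n) u)"

lemma is_subfield_tower: "is_subfield (tower u n)"
  by (induction n) (auto simp: is_subfield_range is_subfield_adjoin)

lemma tower_mono: "m \<le> n \<Longrightarrow> tower u m \<subseteq> tower u n"
  by (rule lift_Suc_mono_le[of "tower u"]) (auto intro!: subset_adjoin is_subfield_tower)

lemma in_tower: "(der ^^ n) u \<in> tower u (Suc n)"
  by (simp add: self_in_adjoin is_subfield_tower)

lemma der_tower: "s \<in> tower u n \<Longrightarrow> der s \<in> tower u (Suc n)"
proof (induction n arbitrary: s)
  case 0
  then obtain c where "s = \<iota> c" by auto
  then have "der s \<in> tower u 0" by (simp add: \<iota>_der[symmetric])
  then show ?case using tower_mono[of 0 "Suc 0" u] by blast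
next
  case (Suc n)
  let ?x = "(der ^^ n) u" and ?L = "tower u (Suc (Suc n))"
  note L = is_subfieldD[OF is_subfield_tower[of u "Suc (Suc n)"]]
  from Suc.prems obtain p q where *: "poly_over (tower u n) p" "poly_over (tower u n) q" "poly q ?x \<noteq> 0"
    "s = poly p ?x / poly q ?x" by (auto simp: adjoin_def)
  have x: "?x \<in> ?L" "der ?x \<in> ?L"
    using in_tower[of n u] in_tower[of "Suc n" u] tower_mono[of "Suc n" "Suc (Suc n)" u] by auto
  have poly: "poly f ?x \<in> ?L" "der (poly f ?x) \<in> ?L" if "poly_over (tower u n) f" for f
  proof -
    have sub: "tower u n \<subseteq> ?L" "tower u (Suc n) \<subseteq> ?L" by (rule tower_mono; simp)+
    have over: "poly_over ?L f" "poly_over ?L (map_poly der f)"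
      using that Suc.IH sub unfolding poly_over_def by (auto simp del: tower.simps simp: coeff_map_poly)
    then show "poly f ?x \<in> ?L" "der (poly f ?x) \<in> ?L"
      unfolding der_poly
      by (auto simp del: tower.simps intro!: L(3,4) x poly_in_subfield is_subfield_tower poly_over_closed(6))
  qed
  show ?case unfolding *(4) der_divide[OF *(3)] by (intro L poly *)
qed

lemma tower_least:
  assumes "is_subfield L" "range \<iota> \<subseteq> L" "\<And>k. k < n \<Longrightarrow> (der ^^ k) u \<in> L"
  shows "tower u n \<subseteq> L"
  using assms(3)
proof (induction n)
  case (Suc n)
  then have "tower u n \<subseteq> L" "(der ^^ n) u \<in> L" by auto
  then show ?case using adjoin_least[OF assms(1)] by simp
qed (simp add: assms(2))

lemma dfield_gen_tower: "dfield_gen \<iota> {u} \<subseteq> (\<Union>n. tower u n)"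
proof (rule dfield_gen_least)
  let ?U = "\<Union>n. tower u n"
  have UI: "a \<in> ?U" if "a \<in> tower u n" for a n using that by blast
  note K = is_subfieldD[OF is_subfield_tower]
  have bin: "a + b \<in> ?U \<and> a * b \<in> ?U" if "a \<in> ?U" "b \<in> ?U" for a b
  proof -
    from that obtain m n where "a \<in> tower u m" "b \<in> tower u n" by blast
    then have "a \<in> tower u (max m n)" "b \<in> tower u (max m n)"
      using tower_mono[of m "max m n" u] tower_mono[of n "max m n" u] by auto
    then show ?thesis using K(3,4) UI by metis
  qed
  have un: "- a \<in> ?U \<and> inverse a \<in> ?U \<and> der a \<in> ?U" if "a \<in> ?U" for a
  proof -
    from that obtain n where "a \<in> tower u n" by blast
    then show ?thesis using K(5,6) der_tower UI by metis
  qed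
  have "0 \<in> ?U" "1 \<in> ?U" by (rule UI[of _ 0], rule K)+
  then show "differential_subfield ?U" using bin un unfolding differential_subfield_def by (intro conjI ballI) simp_all
  show "range \<iota> \<subseteq> ?U" using UI[of _ 0] by auto
  show "{u} \<subseteq> ?U" using UI[OF in_tower[of 0 u]] by (simp only: funpow_0 insert_subset empty_subsetI simp_thms)
qed

sublocale poly_coeffs: coefficient_hom "\<lambda>c. [:\<iota> c:]"
  by unfold_locales (simp_all add: hom_one hom_add hom_mult one_pCons)

text \<open>A relation for \<open>u\<^sup>(\<^sup>n\<^sup>)\<close> over the field generated by the lower derivatives becomes, after clearing
denominators, a differential polynomial \<open>P\<close> that vanishes at \<open>u\<close>; so \<open>P = 0\<close>. To read off from this that
the relation was trivial, all variables but the \<open>n\<close>-th are evaluated and the \<open>n\<close>-th is kept as a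
polynomial variable. This evaluation \<open>\<psi>\<close> maps \<open>P\<close> to a nonzero multiple of the relation.\<close>

lemma diff_transcendental_tower:
  assumes u: "diff_transcendental \<iota> u"
  shows "transcendental_over (tower u n) ((der ^^ n) u)"
proof -
  define \<psi> :: "(unit, 'f) dpoly \<Rightarrow> 'e poly" where
    "\<psi> = eval_poly_mapping (\<lambda>c. [:\<iota> c:]) (\<lambda>w. if snd w = n then [:0, 1:] else [:(der ^^ snd w) u:])"
  define ev where "ev p = deval \<iota> p (\<lambda>_::unit. u)" for p
  have \<psi>: "\<psi> (p + q) = \<psi> p + \<psi> q" "\<psi> (p * q) = \<psi> p * \<psi> q" "\<psi> 0 = 0" for p q
    by (simp_all add: \<psi>_def)
  have \<psi>_const: "\<psi> (dconst c) = [:\<iota> c:]" for c by (simp add: \<psi>_def dconst_def monomial_value_def)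
  have \<psi>_var: "\<psi> (dvar w) = (if snd w = n then [:0, 1:] else [:(der ^^ snd w) u:])" for w
    by (simp add: \<psi>_def dvar_def monomial_value_def hom_one)
  have ev: "ev (p + q) = ev p + ev q" "ev (p * q) = ev p * ev q" "ev (dconst c) = \<iota> c"
    "ev (dvar w) = (der ^^ snd w) u" "ev (- p) = - ev p" for p q c w
    by (simp_all add: ev_def)
  \<comment> \<open>The ring \<open>A\<close> takes the place of the differential polynomials free of the \<open>n\<close>-th derivative:
    \<open>\<psi>\<close> maps them to constant polynomials.\<close>
  define A where "A = {p. \<psi> p = [:ev p:]}"
  have A: "p + q \<in> A" "p * q \<in> A" if "p \<in> A" "q \<in> A" for p q
    using that by (simp_all add: A_def \<psi> ev)
  have A_const: "dconst c \<in> A" for c by (simp add: A_def \<psi>_const ev)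
  have A_var: "dvar w \<in> A" if "snd w \<noteq> n" for w using that by (simp add: A_def \<psi>_var ev)
  have dconst: "ev (dconst 0) = 0" "ev (dconst 1) = 1" by (simp_all add: ev hom_zero hom_one)
  define F where "F = {ev p / ev q | p q. p \<in> A \<and> q \<in> A \<and> ev q \<noteq> 0}"
  have FI: "s \<in> F" if "p \<in> A" "q \<in> A" "ev q \<noteq> 0" "s = ev p / ev q" for p q s
    unfolding F_def using that by blast
  have F_ev: "ev p \<in> F" if "p \<in> A" for p
    by (rule FI[of p "dconst 1"]) (use that dconst A_const in auto)
  have bin: "a + b \<in> F \<and> a * b \<in> F" if "a \<in> F" "b \<in> F" for a b
  proof -
    from that obtain p q p' q' where *: "p \<in> A" "q \<in> A" "ev q \<noteq> 0" "a = ev p / ev q"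
      "p' \<in> A" "q' \<in> A" "ev q' \<noteq> 0" "b = ev p' / ev q'" unfolding F_def by blast
    show ?thesis
    proof
      show "a + b \<in> F" by (rule FI[of "p * q' + p' * q" "q * q'"]) (use * A in \<open>auto simp: ev add_frac_eq\<close>)
      show "a * b \<in> F" by (rule FI[of "p * p'" "q * q'"]) (use * A in \<open>auto simp: ev\<close>)
    qed
  qed
  have un: "- a \<in> F \<and> inverse a \<in> F" if "a \<in> F" for a
  proof -
    from that obtain p q where *: "p \<in> A" "q \<in> A" "ev q \<noteq> 0" "a = ev p / ev q" unfolding F_def by blast
    have "- a \<in> F"
      by (rule FI[of "dconst (-1) * p" q]) (use * A A_const in \<open>auto simp: ev hom_uminus hom_one\<close>)
    moreover have "inverse a \<in> F" if "a \<noteq> 0" by (rule FI[of q p]) (use * that in auto)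
    moreover have "0 \<in> F" using F_ev[OF A_const[of 0]] dconst by simp
    ultimately show ?thesis by (cases "a = 0") auto
  qed
  have "0 \<in> F" "1 \<in> F" using F_ev[OF A_const] dconst by metis+
  then have "is_subfield F" using bin un unfolding is_subfield_def by blast
  moreover have "range \<iota> \<subseteq> F" using F_ev[OF A_const] by (auto simp: ev)
  moreover have "(der ^^ k) u \<in> F" if "k < n" for k
    using F_ev[OF A_var[of "((), k)"]] that by (simp add: ev)
  ultimately have sub: "tower u n \<subseteq> F" by (rule tower_least)
  have clear: "\<exists>d P. d \<in> A \<and> ev d \<noteq> 0 \<and> \<psi> P = smult (ev d) f \<and> ev P = ev d * poly f ((der ^^ n) u)"
    if "poly_over F f" for f
    using that
  proof (induction f)
    case 0
    show ?case
      by (intro exI[of _ "dconst 1"] exI[of _ 0]) (auto simp: dconst A_const \<psi> ev_def)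
  next
    case (pCons a f)
    then obtain d P where d: "d \<in> A" "ev d \<noteq> 0" "\<psi> P = smult (ev d) f" "ev P = ev d * poly f ((der ^^ n) u)"
      by auto
    from pCons.prems obtain p q where pq: "p \<in> A" "q \<in> A" "ev q \<noteq> 0" "a = ev p / ev q"
      unfolding F_def by auto
    show ?case
    proof (intro exI conjI)
      show "q * d \<in> A" "ev (q * d) \<noteq> 0" using d pq A by (auto simp: ev)
      have "\<psi> p = [:ev p:]" "\<psi> q = [:ev q:]" "\<psi> d = [:ev d:]" using pq d by (auto simp: A_def)
      then show "\<psi> (d * p + q * dvar ((), n) * P) = smult (ev (q * d)) (pCons a f)"
        using pq by (simp add: \<psi> \<psi>_var d ev mult.commute)
      show "ev (d * p + q * dvar ((), n) * P) = ev (q * d) * poly (pCons a f) ((der ^^ n) u)"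
        using pq by (simp add: ev d field_simps)
    qed
  qed
  show ?thesis unfolding transcendental_over_def
  proof (intro allI impI)
    fix f assume f: "poly_over (tower u n) f" "poly f ((der ^^ n) u) = 0"
    then have "poly_over F f" using sub by (auto simp: poly_over_def)
    then obtain d P where d: "ev d \<noteq> 0" "\<psi> P = smult (ev d) f" "ev P = 0"
      using clear[of f] f(2) by auto
    then have "P = 0" using u unfolding diff_transcendental_def ev_def by blast
    then show "f = 0" using d \<psi>(3) by simp
  qed
qed

text \<open>If \<open>s\<close> has order exactly \<open>n\<close> in \<open>u\<close>, then each of its derivatives of order \<open>k > 0\<close> is linear in the
highest derivative \<open>u\<^sup>(\<^sup>n\<^sup>+\<^sup>k\<^sup>)\<close>, because the first
differentiation produces it with the partial derivative of \<open>s\<close> by \<open>u\<^sup>(\<^sup>n\<^sup>)\<close> as coefficient, and each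
further one keeps this coefficient and only raises the order.\<close>

lemma derivative_leading_term:
  assumes u: "diff_transcendental \<iota> u" and s: "s \<in> tower u (Suc n)" "s \<notin> tower u n"
  shows "\<exists>a\<in>tower u (n + Suc k). \<exists>b\<in>tower u (n + Suc k). a \<noteq> 0 \<and>
    (der ^^ Suc k) s = a * (der ^^ (n + Suc k)) u + b"
proof (induction k)
  case 0
  have "der ` tower u n \<subseteq> adjoin (tower u n) ((der ^^ n) u)"
    using der_tower by force
  from adjoin_derivation[OF is_subfield_tower this diff_transcendental_tower[OF u]] s
  show ?case by simp metis
next
  case (Suc k)
  then obtain a b where ab: "a \<in> tower u (n + Suc k)" "b \<in> tower u (n + Suc k)" "a \<noteq> 0"
    "(der ^^ Suc k) s = a * (der ^^ (n + Suc k)) u + b" by blast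
  let ?L = "tower u (Suc (n + Suc k))"
  have "a \<in> ?L" using subsetD[OF tower_mono ab(1)] by (simp del: tower.simps)
  moreover have "der a * (der ^^ (n + Suc k)) u + der b \<in> ?L"
    using is_subfieldD(3,4)[OF is_subfield_tower] der_tower in_tower ab(1,2) by metis
  moreover have "(der ^^ Suc (Suc k)) s = a * (der ^^ (Suc (n + Suc k))) u + (der a * (der ^^ (n + Suc k)) u + der b)"
  proof -
    have "(der ^^ Suc (Suc k)) s = der ((der ^^ Suc k) s)" by simp
    then show ?thesis unfolding ab(4) by (simp add: der_add der_mult algebra_simps)
  qed
  ultimately show ?case using ab(3) unfolding add_Suc_right by blast
qed

lemma tower_order:
  assumes "s \<in> dfield_gen \<iota> {u}" "s \<notin> range \<iota>"
  obtains n where "s \<in> tower u (Suc n)" "s \<notin> tower u n"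
proof -
  define l where "l = (LEAST n. s \<in> tower u n)"
  have "\<exists>n. s \<in> tower u n" using dfield_gen_tower[of u] assms(1) by blast
  then have in_l: "s \<in> tower u l" unfolding l_def by (rule LeastI_ex)
  then have "l \<noteq> 0" using assms(2) by (intro notI) simp
  then obtain m where m: "l = Suc m" using not0_implies_Suc by blast
  have "s \<notin> tower u m" by (rule not_less_Least) (simp only: m lessI flip: l_def)
  with in_l show ?thesis unfolding m by (rule that)
qed

lemma diff_transcendental_not_const: "diff_transcendental \<iota> u \<Longrightarrow> u \<notin> range \<iota>"
  using transcendental_over_not_in[OF is_subfield_tower diff_transcendental_tower, of u 0] by simp

text \<open>Orders add under composition: if \<open>r\<close> has order \<open>n\<close> in \<open>u\<close> and \<open>u\<close> has order \<open>m\<close> in \<open>r\<close>, then \<open>u\<close>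
would have order \<open>n + m\<close> in itself, so \<open>n = m = 0\<close>. The argument is run for \<open>der u\<close> in place of \<open>u\<close>:
for a proper derivative the dependence on the highest derivatives is linear, so composing the two
dependences shows \<open>der u \<notin> tower u (n + m + 1)\<close> by solving a linear equation.\<close>

lemma same_dfield_order_zero:
  assumes u: "diff_transcendental \<iota> u" and r: "diff_transcendental \<iota> r"
    and ru: "r \<in> dfield_gen \<iota> {u}" and ur: "u \<in> dfield_gen \<iota> {r}"
  shows "r \<in> tower u 1" "u \<in> tower r 1"
proof -
  obtain n where n: "r \<in> tower u (Suc n)" "r \<notin> tower u n"
    using tower_order[OF ru diff_transcendental_not_const[OF r]] .
  obtain m where m: "u \<in> tower r (Suc m)" "u \<notin> tower r m"
    using tower_order[OF ur diff_transcendental_not_const[OF u]] .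
  let ?N = "n + Suc m"
  note K = is_subfieldD[OF is_subfield_tower[of u ?N]]
  have sub: "tower r (Suc m) \<subseteq> tower u ?N"
  proof (rule tower_least[OF is_subfield_tower])
    show "range \<iota> \<subseteq> tower u ?N" using tower_mono[of 0 ?N u] by simp
    fix k assume "k < Suc m"
    have "(der ^^ k) r \<in> tower u (Suc n + k)" 
      by (induction k) (use n(1) der_tower in \<open>auto simp del: tower.simps\<close>)
    then show "(der ^^ k) r \<in> tower u ?N" using tower_mono[of "Suc n + k" ?N u] \<open>k < Suc m\<close> by auto
  qed
  from derivative_leading_term[OF u n, of m] obtain a b where ab: "a \<in> tower u ?N" "b \<in> tower u ?N" "a \<noteq> 0"
    "(der ^^ Suc m) r = a * (der ^^ ?N) u + b" by blast
  from derivative_leading_term[OF r m, of 0] obtain c d where cd: "c \<in> tower r (Suc m)" "d \<in> tower r (Suc m)" "c \<noteq> 0"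
    "der u = c * (der ^^ Suc m) r + d" by auto
  \<comment> \<open>Otherwise \<open>u\<^sup>(\<^sup>n\<^sup>+\<^sup>m\<^sup>+\<^sup>1\<^sup>)\<close> could be solved for in terms of lower derivatives.\<close>
  have "der u \<notin> tower u ?N"
  proof
    assume "der u \<in> tower u ?N"
    then have "((der u - d) / c - b) / a \<in> tower u ?N" using ab cd sub by (intro K) auto
    moreover have "((der u - d) / c - b) / a = (der ^^ ?N) u" using ab cd by (simp add: field_simps)
    ultimately show False
      using transcendental_over_not_in[OF is_subfield_tower diff_transcendental_tower[OF u], of ?N] by simp
  qed
  then have "\<not> 2 \<le> ?N" using in_tower[of 1 u] tower_mono[of 2 ?N u] by (auto simp: numeral_2_eq_2)
  then have "n = 0" "m = 0" by auto
  then show "r \<in> tower u 1" "u \<in> tower r 1" using n m by auto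
qed

end

section \<open>Reduced fractions\<close>

lemma monomial_value_linear:
  "monomial_value (\<lambda>w. [:0, g w:]) m =
   monom (monomial_value g m) (\<Sum>w\<in>Poly_Mapping.keys m. Poly_Mapping.lookup m w)"
proof -
  have "(\<Prod>w\<in>S. [:0, g w:] ^ e w) = monom (\<Prod>w\<in>S. g w ^ e w) (\<Sum>w\<in>S. e w)"
    if "finite S" for S e
    using that
  proof induction
    case (insert w S)
    have "[:0, g w:] = monom (g w) 1" by (simp add: monom_altdef)
    then show ?case using insert by (simp add: monom_power mult_monom)
  qed (simp add: monom_0 one_pCons)
  then show ?thesis by (simp add: monomial_value_def)
qed

context diff_extension
begin

text \<open>Among all representations of \<open>w\<close> take one whose denominator has least total degree. A common divisor
of numerator and denominator then has degree 0, so it is a constant. The total degree is obtained from the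
homomorphism \<open>\<phi>\<close> that sends the variable \<open>u\<^sup>(\<^sup>k\<^sup>)\<close> to \<open>u\<^sup>(\<^sup>k\<^sup>)\<close> times a new variable, because
degrees of polynomials in one variable over a field are additive; homogeneous parts survive
since \<open>u\<close> is differentially transcendental.\<close>

lemma reduced_quotient:
  assumes u: "diff_transcendental \<iota> u" and w: "w \<in> dfield_gen \<iota> {u}"
  obtains p q :: "(unit, 'f) dpoly" where "q \<noteq> 0" "gcd_one p q"
    "w = deval \<iota> p (\<lambda>_. u) / deval \<iota> q (\<lambda>_. u)"
proof -
  let ?ev = "\<lambda>p :: (unit, 'f) dpoly. deval \<iota> p (\<lambda>_. u)"
  let ?u = "\<lambda>w :: unit \<times> nat. (der ^^ snd w) u"
  define \<phi> :: "(unit, 'f) dpoly \<Rightarrow> 'e poly" where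
    "\<phi> = eval_poly_mapping (\<lambda>c. [:\<iota> c:]) (\<lambda>w. [:0, ?u w:])"
  let ?deg = "\<lambda>m :: unit \<times> nat \<Rightarrow>\<^sub>0 nat. \<Sum>w\<in>Poly_Mapping.keys m. Poly_Mapping.lookup m w"
  have \<phi>_eq: "\<phi> d = (\<Sum>m\<in>Poly_Mapping.keys d. monom (\<iota> (Poly_Mapping.lookup d m) * monomial_value ?u m) (?deg m))" for d
    by (simp add: \<phi>_def eval_poly_mapping_def monomial_value_linear smult_monom)
  have ev_zero: "?ev p = 0 \<longleftrightarrow> p = 0" for p
    using u deval_0 unfolding diff_transcendental_def by blast
  have \<phi>_mult: "\<phi> (p * q) = \<phi> p * \<phi> q" for p q by (simp add: \<phi>_def)
  have \<phi>_1: "poly (\<phi> p) 1 = ?ev p" for p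
    by (simp add: \<phi>_eq poly_sum poly_monom deval_def monomial_value_def)
  have \<phi>_nz: "\<phi> p \<noteq> 0" if "p \<noteq> 0" for p
  proof
    assume "\<phi> p = 0"
    then have "?ev p = 0" using \<phi>_1[of p] by simp
    then show False using that ev_zero by blast
  qed
  have const: "\<exists>c. d = dconst c" if "degree (\<phi> d) = 0" for d
  proof -
    have "m = 0" if m: "m \<in> Poly_Mapping.keys d" for m
    proof (rule ccontr)
      assume "m \<noteq> 0"
      then obtain w where "w \<in> Poly_Mapping.keys m" by (metis keys_eq_empty equals0I)
      then have "Poly_Mapping.lookup m w \<noteq> 0" by (simp add: in_keys_iff)
      then have pos: "?deg m > 0" using \<open>w \<in> Poly_Mapping.keys m\<close> by (intro sum_pos2[of _ w]) auto
      \<comment> \<open>\<open>?h\<close> is the homogeneous part of \<open>d\<close> that contains \<open>m\<close>.\<close>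
      let ?S = "{n \<in> Poly_Mapping.keys d. ?deg n = ?deg m}"
      let ?h = "\<Sum>n\<in>?S. Poly_Mapping.single n (Poly_Mapping.lookup d n)"
      have "?ev ?h = (\<Sum>n\<in>?S. \<iota> (Poly_Mapping.lookup d n) * monomial_value ?u n)"
        by (simp add: deval_eq eval_sum)
      also have "\<dots> = coeff (\<phi> d) (?deg m)"
        by (simp add: \<phi>_eq coeff_sum sum.If_cases Int_def)
      also have "\<dots> = 0" using that \<open>degree (\<phi> d) = 0\<close> pos by (simp add: coeff_eq_0)
      finally have "?h = 0" by (simp add: ev_zero)
      then have "Poly_Mapping.lookup ?h m = 0" by simp
      moreover have "Poly_Mapping.lookup ?h m = Poly_Mapping.lookup d m"
        using m by (simp add: lookup_sum lookup_single when_def)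
      ultimately show False using m by (simp add: in_keys_iff)
    qed
    then have "d = dconst (Poly_Mapping.lookup d 0)"
      by (intro poly_mapping_eqI) (metis dconst_def in_keys_iff lookup_single_eq lookup_single_not_eq)
    then show ?thesis by blast
  qed
  let ?den = "\<lambda>q. \<exists>p. q \<noteq> 0 \<and> w = ?ev p / ?ev q"
  have "w \<in> dfield_gen \<iota> (range (\<lambda>_::unit. u))" using w by simp
  then obtain p0 q0 where "?ev q0 \<noteq> 0" "w = ?ev p0 / ?ev q0" by (rule dfield_gen_quotient)
  then have "?den q0" by auto
  then obtain q where "?den q" and min: "\<And>q'. ?den q' \<Longrightarrow> degree (\<phi> q) \<le> degree (\<phi> q')"
    using ex_has_least_nat[of ?den q0 "\<lambda>q. degree (\<phi> q)"] by blast
  then obtain p where q: "q \<noteq> 0" and w_eq: "w = ?ev p / ?ev q" by blast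
  have "gcd_one p q" unfolding gcd_one_def
  proof (intro allI impI)
    fix d assume "d dvd p" "d dvd q"
    then obtain p' q' where pq: "p = d * p'" "q = d * q'" unfolding dvd_def by blast
    then have nz: "d \<noteq> 0" "q' \<noteq> 0" using q by auto
    then have "w = ?ev p' / ?ev q'" by (simp add: w_eq pq ev_zero)
    then have "degree (\<phi> q) \<le> degree (\<phi> q')" using nz by (intro min) blast
    moreover have "degree (\<phi> q) = degree (\<phi> d) + degree (\<phi> q')"
      unfolding pq \<phi>_mult using nz by (simp add: degree_mult_eq \<phi>_nz)
    ultimately obtain c where "d = dconst c" using const[of d] by auto
    moreover from this have "c \<noteq> 0" using nz by (auto simp: dconst_def)
    ultimately have "1 = d * dconst (inverse c)" by (simp add: dconst_def mult_single)
    then show "d dvd 1" by (rule dvdI)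
  qed
  then show ?thesis using that q w_eq by blast
qed

section \<open>Moebius transformations\<close>

lemma moebius_denominator:
  assumes "u \<notin> range \<iota>" "a * d - b * c \<noteq> 0"
  shows "\<iota> c * u + \<iota> d \<noteq> 0"
proof
  assume 0: "\<iota> c * u + \<iota> d = 0"
  show False
  proof (cases "c = 0")
    case True
    then show ?thesis using 0 assms(2) by (simp add: hom_zero)
  next
    case False
    have "\<iota> c * u = - \<iota> d" using 0 by (simp add: eq_neg_iff_add_eq_0)
    then have "u = - \<iota> d / \<iota> c" using False by (intro eq_divide_imp) (simp_all add: mult.commute)
    then have "u = \<iota> (- d / c)" by (simp only: \<iota>_divide hom_uminus)
    then show ?thesis using assms(1) by blast
  qed
qed

lemma moebius_inverse:
  assumes u: "u \<notin> range \<iota>" and det: "a * d - b * c \<noteq> 0"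
  shows "moebius \<iota> a b c d (moebius \<iota> d (- b) (- c) a u) = u"
    "\<iota> c * moebius \<iota> d (- b) (- c) a u + \<iota> d \<noteq> 0"
    "moebius \<iota> d (- b) (- c) a (moebius \<iota> a b c d u) = u"
proof -
  have "\<iota> (a * d - b * c) \<noteq> 0" using det by simp
  then have D: "\<iota> a * \<iota> d - \<iota> b * \<iota> c \<noteq> 0" unfolding hom_diff hom_mult .
  have q: "\<iota> a - \<iota> c * u \<noteq> 0"
    using moebius_denominator[OF u, of d a "-b" "-c"] det by (simp add: hom_uminus algebra_simps)
  have q': "\<iota> c * u + \<iota> d \<noteq> 0" by (rule moebius_denominator[OF u det])
  have m: "moebius \<iota> d (- b) (- c) a x = (\<iota> d * x - \<iota> b) / (\<iota> a - \<iota> c * x)" for x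
    by (simp add: moebius_def hom_uminus)
  have e1: "\<iota> c * moebius \<iota> d (- b) (- c) a u + \<iota> d = (\<iota> a * \<iota> d - \<iota> b * \<iota> c) / (\<iota> a - \<iota> c * u)"
    unfolding m using q by (simp add: field_simps)
  have e2: "\<iota> a * moebius \<iota> d (- b) (- c) a u + \<iota> b = (\<iota> a * \<iota> d - \<iota> b * \<iota> c) * u / (\<iota> a - \<iota> c * u)"
    unfolding m using q by (simp add: field_simps)
  show "\<iota> c * moebius \<iota> d (- b) (- c) a u + \<iota> d \<noteq> 0" unfolding e1 using D q by simp
  show "moebius \<iota> a b c d (moebius \<iota> d (- b) (- c) a u) = u"
    unfolding moebius_def[of _ a b c d] e1 e2 using D q by simp
  have e3: "\<iota> a - \<iota> c * moebius \<iota> a b c d u = (\<iota> a * \<iota> d - \<iota> b * \<iota> c) / (\<iota> c * u + \<iota> d)"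
    unfolding moebius_def using q' by (simp add: field_simps)
  have e4: "\<iota> d * moebius \<iota> a b c d u - \<iota> b = (\<iota> a * \<iota> d - \<iota> b * \<iota> c) * u / (\<iota> c * u + \<iota> d)"
    unfolding moebius_def using q' by (simp add: field_simps)
  show "moebius \<iota> d (- b) (- c) a (moebius \<iota> a b c d u) = u"
    unfolding m e3 e4 using D q' by simp
qed

lemma moebius_in_dfield:
  assumes "differential_subfield K" "range \<iota> \<subseteq> K" "v \<in> K"
  shows "moebius \<iota> a b c d v \<in> K"
proof -
  have "\<iota> x \<in> K" for x using assms(2) by blast
  then show ?thesis unfolding moebius_def
    by (intro differential_subfieldD(3,4,8)[OF assms(1)] assms(3))
qed

lemma hom_of_nat: "\<iota> (of_nat n) = of_nat n"
  by (induction n) (simp_all add: hom_zero hom_one hom_add)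

lemma der_power: "x * der (x ^ n) = of_nat n * x ^ n * der (x :: 'e)"
proof (induction n)
  case (Suc n)
  have "x * der (x ^ Suc n) = der x * x ^ Suc n + x * (x * der (x ^ n))"
    by (simp add: der_mult algebra_simps)
  then show ?case unfolding Suc by (simp add: algebra_simps)
qed simp

text \<open>As \<open>P\<close> and \<open>N\<close> do not depend on \<open>v\<close>, an identity that holds at a differentially transcendental
point carries over to every \<open>v\<close> at which the transformation is defined.\<close>

lemma moebius_clear_denominators:
  fixes p :: "(unit, 'f) dpoly"
  obtains P :: "(unit, 'f) dpoly" and N where "\<And>v. \<iota> c * v + \<iota> d \<noteq> 0 \<Longrightarrow>
    deval \<iota> p (\<lambda>_. moebius \<iota> a b c d v) * (\<iota> c * v + \<iota> d) ^ N = deval \<iota> P (\<lambda>_. v)"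
proof -
  let ?ok = "\<lambda>g :: 'e \<Rightarrow> 'e. \<exists>(P :: (unit, 'f) dpoly) N. \<forall>v. \<iota> c * v + \<iota> d \<noteq> 0 \<longrightarrow>
    g v * (\<iota> c * v + \<iota> d) ^ N = deval \<iota> P (\<lambda>_. v)"
  define D :: "(unit, 'f) dpoly" where "D = dconst c * dvar ((), 0) + dconst d"
  have D: "deval \<iota> D (\<lambda>_. v) = \<iota> c * v + \<iota> d" for v by (simp add: D_def)
  obtain D' where D': "\<And>\<eta>. deval \<iota> D' \<eta> = der (deval \<iota> D \<eta>)" using deval_derivative[of D] by blast
  have ok_der: "?ok (\<lambda>v. der (g v))" if g: "?ok g" for g
  proof -
    from g obtain P :: "(unit, 'f) dpoly" and N where
      P: "\<And>v. \<iota> c * v + \<iota> d \<noteq> 0 \<Longrightarrow> g v * (\<iota> c * v + \<iota> d) ^ N = deval \<iota> P (\<lambda>_. v)" by blast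
    obtain P' where P': "\<And>\<eta>. deval \<iota> P' \<eta> = der (deval \<iota> P \<eta>)" using deval_derivative[of P] by blast
    have "der (g v) * (\<iota> c * v + \<iota> d) ^ Suc N = deval \<iota> (P' * D - dconst (of_nat N) * P * D') (\<lambda>_. v)"
      if v: "\<iota> c * v + \<iota> d \<noteq> 0" for v
    proof -
      let ?D = "\<iota> c * v + \<iota> d"
      have "der (deval \<iota> P (\<lambda>_. v)) = der (g v) * ?D ^ N + g v * der (?D ^ N)"
        unfolding P[OF v, symmetric] by (rule der_mult)
      then have "der (deval \<iota> P (\<lambda>_. v)) * ?D = der (g v) * ?D ^ Suc N + g v * (?D * der (?D ^ N))"
        by (simp add: algebra_simps)
      then show ?thesis
        by (simp add: der_power P' D D' P[OF v, symmetric] hom_of_nat algebra_simps)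
    qed
    then show ?thesis by blast
  qed
  have "?ok (\<lambda>v. deval \<iota> p (\<lambda>_. moebius \<iota> a b c d v))"
  proof (induction p rule: dpoly_induct)
    case (const e)
    show ?case by (intro exI[of _ "dconst e"] exI[of _ 0]) simp
  next
    case (var w)
    have "?ok (\<lambda>v. (der ^^ k) (moebius \<iota> a b c d v))" for k
    proof (induction k)
      case 0
      show ?case
        by (intro exI[of _ "dconst a * dvar ((), 0) + dconst b"] exI[of _ 1]) (simp add: moebius_def)
    next
      case (Suc k)
      from ok_der[OF this] show ?case by simp
    qed
    then show ?case by simp
  next
    case (add p q)
    then obtain P Q :: "(unit, 'f) dpoly" and M N where
      "\<forall>v. \<iota> c * v + \<iota> d \<noteq> 0 \<longrightarrow> deval \<iota> p (\<lambda>_. moebius \<iota> a b c d v) * (\<iota> c * v + \<iota> d) ^ M = deval \<iota> P (\<lambda>_. v)"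
      "\<forall>v. \<iota> c * v + \<iota> d \<noteq> 0 \<longrightarrow> deval \<iota> q (\<lambda>_. moebius \<iota> a b c d v) * (\<iota> c * v + \<iota> d) ^ N = deval \<iota> Q (\<lambda>_. v)"
      by blast
    then show ?case
      by (intro exI[of _ "P * D ^ N + Q * D ^ M"] exI[of _ "M + N"])
        (auto simp: D power_add distrib_right simp flip: mult.assoc)
  next
    case (mult p q)
    then obtain P Q :: "(unit, 'f) dpoly" and M N where
      "\<forall>v. \<iota> c * v + \<iota> d \<noteq> 0 \<longrightarrow> deval \<iota> p (\<lambda>_. moebius \<iota> a b c d v) * (\<iota> c * v + \<iota> d) ^ M = deval \<iota> P (\<lambda>_. v)"
      "\<forall>v. \<iota> c * v + \<iota> d \<noteq> 0 \<longrightarrow> deval \<iota> q (\<lambda>_. moebius \<iota> a b c d v) * (\<iota> c * v + \<iota> d) ^ N = deval \<iota> Q (\<lambda>_. v)"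
      by blast
    then show ?case
      by (intro exI[of _ "P * Q"] exI[of _ "M + N"])
        (auto simp: power_add mult_ac)
  qed
  then show ?thesis using that by blast
qed

text \<open>If \<open>p\<close> vanishes at \<open>m(u)\<close>, then the numerator \<open>P\<close> of \<open>p(m(v))\<close> vanishes at \<open>v = u\<close>, hence is zero.
Thus \<open>p(m(v)) = 0\<close> for all admissible \<open>v\<close>; the choice \<open>v = m\<^sup>-\<^sup>1(u)\<close> gives \<open>p(u) = 0\<close>, that is,
\<open>p = 0\<close>.\<close>

lemma diff_transcendental_moebius:
  assumes u: "diff_transcendental \<iota> u" and det: "a * d - b * c \<noteq> 0"
  shows "diff_transcendental \<iota> (moebius \<iota> a b c d u)"
  unfolding diff_transcendental_def
proof (intro allI impI)
  fix p :: "(unit, 'f) dpoly"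
  assume p: "deval \<iota> p (\<lambda>_. moebius \<iota> a b c d u) = 0"
  obtain P :: "(unit, 'f) dpoly" and N where P: "\<And>v. \<iota> c * v + \<iota> d \<noteq> 0 \<Longrightarrow>
    deval \<iota> p (\<lambda>_. moebius \<iota> a b c d v) * (\<iota> c * v + \<iota> d) ^ N = deval \<iota> P (\<lambda>_. v)"
    using moebius_clear_denominators[of c d p a b] by blast
  note u' = diff_transcendental_not_const[OF u]
  have "deval \<iota> P (\<lambda>_. u) = 0"
    using P[OF moebius_denominator[OF u' det]] p by simp
  then have "P = 0" using u unfolding diff_transcendental_def by blast
  then have "deval \<iota> p (\<lambda>_. u) = 0"
    using P[OF moebius_inverse(2)[OF u' det]] moebius_inverse(1,2)[OF u' det] by simp
  then show "p = 0" using u unfolding diff_transcendental_def by blast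
qed

end

section \<open>Generators of a simple transcendental extension\<close>

text \<open>Euclid's algorithm. The cofactors form a coprime pair, certified by a Bezout identity, over an arbitrary
field without choosing a gcd function.\<close>

lemma poly_coprime_parts:
  fixes s t :: "'a::field poly"
  assumes "s \<noteq> 0 \<or> t \<noteq> 0"
  obtains g s' t' a b where "s = g * s'" "t = g * t'" "a * s' + b * t' = 1"
proof -
  have "s \<noteq> 0 \<or> t \<noteq> 0 \<Longrightarrow> \<exists>g s' t' a b. s = g * s' \<and> t = g * t' \<and> a * s' + b * t' = 1"
  proof (induction "if t = 0 then 0 else Suc (degree t)" arbitrary: s t rule: less_induct)
    case less
    show ?case
    proof (cases "t = 0")
      case True
      then show ?thesis by (intro exI[of _ s] exI[of _ 1] exI[of _ 0]) simp
    next
      case False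
      have "(if s mod t = 0 then 0 else Suc (degree (s mod t))) < (if t = 0 then 0 else Suc (degree t))"
        using degree_mod_less'[OF False] False by auto
      from less(1)[OF this] False obtain g t' m a b where
        *: "t = g * t'" "s mod t = g * m" "a * t' + b * m = 1" by blast
      have "s = g * (s div t * t' + m)"
        using div_mult_mod_eq[of s t] *(1,2) by (simp add: algebra_simps)
      moreover have "b * (s div t * t' + m) + (a - b * (s div t)) * t' = 1"
        using *(3) by (simp add: algebra_simps)
      ultimately show ?thesis using *(1) by blast
    qed
  qed
  then show ?thesis using assms that by blast
qed

lemma dvd_mult_power_coprime:
  fixes s t :: "'a::comm_ring_1"
  assumes "a * s + b * t = 1" "t dvd c * s ^ n"
  shows "t dvd c"
  using assms(2)
proof (induction n)
  case (Suc n)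
  have "c * s ^ n = c * s ^ n * (a * s + b * t)" by (simp add: assms(1))
  also have "\<dots> = a * (c * s ^ Suc n) + t * (b * c * s ^ n)" by (simp add: algebra_simps)
  finally have "t dvd c * s ^ n" using Suc.prems by (metis dvd_add dvd_mult dvd_triv_left)
  then show ?case by (rule Suc.IH)
qed simp

text \<open>The rational root theorem: for the root \<open>s / t\<close> of a polynomial with coefficients \<open>c i\<close>, the denominator
divides the leading coefficient. The coefficients are themselves polynomials of bounded degree,
which bounds the degree of \<open>t\<close>. Leading coefficients that are zero are stripped off first.\<close>

lemma rational_root_degree:
  fixes s t :: "'a::field poly"
  assumes coprime: "a * s + b * t = 1" and t: "t \<noteq> 0"
    and root: "(\<Sum>i\<le>n. c i * s ^ i * t ^ (n - i)) = 0"
    and deg: "\<And>i. degree (c i) \<le> k" and nz: "\<exists>i\<le>n. c i \<noteq> 0"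
  shows "degree t \<le> k"
  using root nz
proof (induction n)
  case 0
  then show ?case by simp
next
  case (Suc n)
  have "(\<Sum>i\<le>n. c i * s ^ i * t ^ (Suc n - i)) = t * (\<Sum>i\<le>n. c i * s ^ i * t ^ (n - i))"
    unfolding sum_distrib_left by (rule sum.cong) (auto simp: Suc_diff_le)
  then have eq: "t * (\<Sum>i\<le>n. c i * s ^ i * t ^ (n - i)) + c (Suc n) * s ^ Suc n = 0"
    using Suc.prems(1) by simp
  show ?case
  proof (cases "c (Suc n) = 0")
    case True
    then have "(\<Sum>i\<le>n. c i * s ^ i * t ^ (n - i)) = 0" using eq t by simp
    moreover obtain i where "i \<le> Suc n" "c i \<noteq> 0" using Suc.prems(2) by blast
    then have "\<exists>i\<le>n. c i \<noteq> 0" using True by (intro exI[of _ i]) (auto simp: le_Suc_eq)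
    ultimately show ?thesis by (intro Suc.IH)
  next
    case False
    have "c (Suc n) * s ^ Suc n = t * (- (\<Sum>i\<le>n. c i * s ^ i * t ^ (n - i)))"
      using eq by (simp add: eq_neg_iff_add_eq_0 add.commute)
    then have "t dvd c (Suc n) * s ^ Suc n" by (rule dvdI)
    then have "t dvd c (Suc n)" by (rule dvd_mult_power_coprime[OF coprime])
    then show ?thesis using dvd_imp_degree_le[of t "c (Suc n)"] False deg[of "Suc n"] by linarith
  qed
qed

context diff_extension
begin

lemma map_poly_hom:
  "map_poly \<iota> (p + q) = map_poly \<iota> p + map_poly \<iota> q"
  "map_poly \<iota> (p * q) = map_poly \<iota> p * map_poly \<iota> q"
  "map_poly \<iota> (p ^ n) = map_poly \<iota> p ^ n"
proof -
  show add: "map_poly \<iota> (p + q) = map_poly \<iota> p + map_poly \<iota> q" for p q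
    by (rule poly_eqI) (simp add: coeff_map_poly hom_zero hom_add)
  have "map_poly \<iota> (smult a q) = smult (\<iota> a) (map_poly \<iota> q)" for a q
    by (rule poly_eqI) (simp add: coeff_map_poly hom_zero hom_mult)
  then show mult: "map_poly \<iota> (p * q) = map_poly \<iota> p * map_poly \<iota> q" for p q
    by (induction p) (simp_all add: map_poly_pCons hom_zero add)
  show "map_poly \<iota> (p ^ n) = map_poly \<iota> p ^ n"
    by (induction n) (simp_all add: mult map_poly_1 hom_zero hom_one)
qed

lemma map_poly_hom_sum: "map_poly \<iota> (\<Sum>i\<in>S. f i) = (\<Sum>i\<in>S. map_poly \<iota> (f i))"
  by (induction S rule: infinite_finite_induct) (simp_all add: map_poly_hom)

lemma map_poly_eq_0: "map_poly \<iota> p = 0 \<Longrightarrow> p = 0"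
  by (simp add: map_poly_eq_0_iff hom_zero)

lemma poly_over_range: "poly_over (range \<iota>) p \<Longrightarrow> \<exists>p'. p = map_poly \<iota> p'"
proof (induction p)
  case (pCons a p)
  then obtain c p' where "a = \<iota> c" "p = map_poly \<iota> p'" by auto
  then have "pCons a p = map_poly \<iota> (pCons c p')" by (simp add: map_poly_pCons hom_zero)
  then show ?case by blast
qed (rule exI[of _ 0], simp)

lemma poly_over_map_poly: "poly_over (range \<iota>) (map_poly \<iota> p)"
  by (simp add: poly_over_def coeff_map_poly hom_zero)

lemma adjoin_rangeE:
  assumes "w \<in> adjoin (range \<iota>) u"
  obtains p q where "poly (map_poly \<iota> q) u \<noteq> 0" "w = poly (map_poly \<iota> p) u / poly (map_poly \<iota> q) u"
proof -
  from assms obtain p q where *: "poly_over (range \<iota>) p" "poly_over (range \<iota>) q" "poly q u \<noteq> 0"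
    "w = poly p u / poly q u" unfolding adjoin_def by blast
  obtain p' q' where "p = map_poly \<iota> p'" "q = map_poly \<iota> q'"
    using poly_over_range *(1,2) by blast
  then show ?thesis using that *(3,4) by blast
qed

lemma poly_map_poly_sum:
  assumes "degree p \<le> n"
  shows "poly (map_poly \<iota> p) x = (\<Sum>i\<le>n. \<iota> (coeff p i) * x ^ i)"
proof -
  have "p = (\<Sum>i\<le>n. monom (coeff p i) i)" using poly_as_sum_of_monoms'[OF assms] by simp
  then have "map_poly \<iota> p = (\<Sum>i\<le>n. map_poly \<iota> (monom (coeff p i) i))" by (metis map_poly_hom_sum)
  then show ?thesis by (simp add: poly_sum map_poly_monom hom_zero poly_monom)
qed

text \<open>Let \<open>r = p(u) / q(u)\<close> and \<open>u = s(r) / t(r)\<close> with \<open>s\<close> and \<open>t\<close> coprime. Then \<open>s / t\<close> is a root of the polynomial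
\<open>p - r q\<close>, whose coefficients \<open>p\<^sub>i - r q\<^sub>i\<close> have degree at most 1 in \<open>r\<close>. By the rational root
theorem \<open>t\<close> has degree at most 1, and so has \<open>s\<close>, by the same argument for the reciprocal \<open>t / s\<close>.
Hence \<open>u\<close> is a fractional linear function of \<open>r\<close>, and it is inverted to express \<open>r\<close>.\<close>

lemma moebius_generator:
  assumes r: "transcendental_over (range \<iota>) r" and u: "u \<notin> range \<iota>"
    and ru: "r \<in> adjoin (range \<iota>) u" and ur: "u \<in> adjoin (range \<iota>) r"
  obtains a b c d where "a * d - b * c \<noteq> 0" "r = moebius \<iota> a b c d u"
proof -
  let ?ev = "\<lambda>p x. poly (map_poly \<iota> p) x"
  obtain s0 t0 where st0: "?ev t0 r \<noteq> 0" "u = ?ev s0 r / ?ev t0 r" using adjoin_rangeE[OF ur] .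
  have "t0 \<noteq> 0" using st0(1) by auto
  then obtain g s t a b where st: "s0 = g * s" "t0 = g * t" and bez: "a * s + b * t = 1"
    using poly_coprime_parts[of s0 t0] by blast
  have T: "?ev t r \<noteq> 0" and u_eq: "u = ?ev s r / ?ev t r"
    using st0 by (simp_all add: st map_poly_hom)
  obtain p q where q: "?ev q u \<noteq> 0" and r_eq: "r = ?ev p u / ?ev q u" using adjoin_rangeE[OF ru] .
  define n where "n = max (degree p) (degree q)"
  define c where "c i = [:coeff p i, - coeff q i:]" for i
  have ev_c: "?ev (c i) r = \<iota> (coeff p i) - r * \<iota> (coeff q i)" for i
    by (simp add: c_def map_poly_pCons hom_zero hom_uminus)
  have "?ev (\<Sum>i\<le>n. c i * s ^ i * t ^ (n - i)) r =
      (\<Sum>i\<le>n. (\<iota> (coeff p i) - r * \<iota> (coeff q i)) * ?ev s r ^ i * ?ev t r ^ (n - i))"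
    by (simp add: map_poly_hom_sum map_poly_hom poly_sum ev_c)
  also have "\<dots> = (\<Sum>i\<le>n. ?ev t r ^ n * (\<iota> (coeff p i) * u ^ i - r * (\<iota> (coeff q i) * u ^ i)))"
  proof (rule sum.cong)
    fix i assume "i \<in> {..n}"
    then have "?ev t r ^ n = ?ev t r ^ i * ?ev t r ^ (n - i)" by (simp flip: power_add)
    moreover have "?ev s r ^ i = u ^ i * ?ev t r ^ i" using T by (simp add: u_eq power_divide)
    ultimately show "(\<iota> (coeff p i) - r * \<iota> (coeff q i)) * ?ev s r ^ i * ?ev t r ^ (n - i) =
      ?ev t r ^ n * (\<iota> (coeff p i) * u ^ i - r * (\<iota> (coeff q i) * u ^ i))"
      by (simp add: algebra_simps)
  qed simp
  also have "\<dots> = ?ev t r ^ n * (?ev p u - r * ?ev q u)"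
  proof -
    have le: "degree p \<le> n" "degree q \<le> n" by (simp_all add: n_def)
    show ?thesis unfolding poly_map_poly_sum[OF le(1)] poly_map_poly_sum[OF le(2)]
      by (simp only: sum_distrib_left sum_subtractf right_diff_distrib)
  qed
  also have "\<dots> = 0" using q by (simp add: r_eq)
  finally have "map_poly \<iota> (\<Sum>i\<le>n. c i * s ^ i * t ^ (n - i)) = 0"
    using r poly_over_map_poly unfolding transcendental_over_def by blast
  then have root: "(\<Sum>i\<le>n. c i * s ^ i * t ^ (n - i)) = 0" by (rule map_poly_eq_0)
  have "(\<Sum>i\<le>n. c (n - i) * t ^ i * s ^ (n - i)) = (\<Sum>i\<le>n. c i * s ^ i * t ^ (n - i))"
    by (rule sum.reindex_bij_witness[of _ "\<lambda>i. n - i" "\<lambda>i. n - i"]) (auto simp: mult_ac)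
  then have root': "(\<Sum>i\<le>n. c (n - i) * t ^ i * s ^ (n - i)) = 0" using root by simp
  have deg: "degree (c i) \<le> 1" for i by (simp add: c_def)
  have "q \<noteq> 0" using q by auto
  then have nz: "c (degree q) \<noteq> 0" "degree q \<le> n" by (simp_all add: c_def n_def)
  have "t \<noteq> 0" using T by auto
  have "s \<noteq> 0"
  proof
    assume "s = 0"
    then have "u = \<iota> 0" by (simp add: u_eq hom_zero)
    then show False using u by blast
  qed
  have "degree t \<le> 1"
    by (rule rational_root_degree[OF bez \<open>t \<noteq> 0\<close> root deg]) (use nz in blast)
  moreover have "degree s \<le> 1"
  proof (rule rational_root_degree[OF _ \<open>s \<noteq> 0\<close> root' deg])
    show "b * t + a * s = 1" using bez by (simp add: add.commute)
    show "\<exists>i\<le>n. c (n - i) \<noteq> 0" using nz by (intro exI[of _ "n - degree q"]) simp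
  qed
  moreover have linear: "f = [:coeff f 0, coeff f 1:]" if "degree f \<le> 1" for f :: "'f poly"
    by (rule poly_eqI) (use that in \<open>auto simp: coeff_pCons coeff_eq_0 split: nat.split\<close>)
  ultimately obtain s0 s1 t0 t1 where s: "s = [:s0, s1:]" and t: "t = [:t0, t1:]" by metis
  have ev_s: "?ev s r = \<iota> s0 + \<iota> s1 * r" and ev_t: "?ev t r = \<iota> t0 + \<iota> t1 * r"
    by (simp_all add: s t map_poly_pCons hom_zero)
  have eq: "u * (\<iota> t0 + \<iota> t1 * r) = \<iota> s0 + \<iota> s1 * r" using T unfolding u_eq ev_s ev_t by simp
  \<comment> \<open>A degenerate transformation would be constant, so \<open>u\<close> would lie in the base field.\<close>
  have det: "t0 * s1 - (- s0) * (- t1) \<noteq> 0"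
  proof
    assume "t0 * s1 - (- s0) * (- t1) = 0"
    then have d0: "s1 * t0 = t1 * s0" by (simp add: algebra_simps)
    show False
    proof (cases "t1 = 0")
      case True
      then have "t0 \<noteq> 0" "s1 = 0" using \<open>t \<noteq> 0\<close> d0 by (auto simp: t)
      then have "u = \<iota> (s0 / t0)" using eq True
        unfolding \<iota>_divide by (simp add: hom_zero field_simps)
      then show False using u by blast
    next
      case False
      have "\<iota> t1 * (\<iota> s0 + \<iota> s1 * r) = \<iota> s1 * (\<iota> t0 + \<iota> t1 * r)"
        using d0 by (simp add: algebra_simps flip: hom_mult)
      then have "\<iota> t1 * u = \<iota> s1" using T unfolding ev_t eq[symmetric] by simp
      then have "u = \<iota> (s1 / t1)" using False
        unfolding \<iota>_divide by (simp add: field_simps)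
      then show False using u by blast
    qed
  qed
  have "\<iota> (- t1) * u + \<iota> s1 \<noteq> 0" by (rule moebius_denominator[OF u det])
  then have "r = moebius \<iota> t0 (- s0) (- t1) s1 u"
    using eq unfolding moebius_def hom_uminus by (simp add: field_simps)
  then show ?thesis using that det by blast
qed

end

section \<open>Proper parametrizations\<close>

context diff_extension
begin

lemma range_coords: "range (coords P) = {fst P, snd P}"
proof -
  have "x = X \<or> x = Y" for x by (cases x) auto
  then have UNIV: "(UNIV :: plane_var set) = {X, Y}" by auto
  show ?thesis unfolding UNIV by simp
qed

lemma dfield_gen_subset:
  assumes "S \<subseteq> dfield_gen \<iota> T"
  shows "dfield_gen \<iota> S \<subseteq> dfield_gen \<iota> T"
  by (intro dfield_gen_least differential_subfield_dfield_gen range_subset_dfield_gen assms)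

lemma quotient_in_dfield:
  assumes "range \<eta> \<subseteq> dfield_gen \<iota> S"
  shows "deval \<iota> p \<eta> / deval \<iota> q \<eta> \<in> dfield_gen \<iota> S"
  by (intro differential_subfieldD(8) deval_in_dfield differential_subfield_dfield_gen
      range_subset_dfield_gen assms)

lemma param_at_in_dfield:
  "fst (param_at \<iota> P r) \<in> dfield_gen \<iota> {r}" "snd (param_at \<iota> P r) \<in> dfield_gen \<iota> {r}"
proof -
  have "range (\<lambda>_::unit. r) \<subseteq> dfield_gen \<iota> {r}" using gen_subset_dfield_gen[of "{r}" \<iota>] by simp
  then show "fst (param_at \<iota> P r) \<in> dfield_gen \<iota> {r}" "snd (param_at \<iota> P r) \<in> dfield_gen \<iota> {r}"
    unfolding param_at_def fst_conv snd_conv by (intro quotient_in_dfield; assumption)+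
qed

text \<open>The image \<open>r\<close> of \<open>u\<close> under a differential automorphism of \<open>\<F>\<langle>u\<rangle>\<close> has order 0 in \<open>u\<close>, so the
automorphism restricts to one of the purely transcendental field \<open>\<F>(u)\<close>.\<close>

lemma automorphism_moebius:
  assumes u: "diff_transcendental \<iota> u" and r: "diff_transcendental \<iota> r"
    and ru: "r \<in> dfield_gen \<iota> {u}" and ur: "u \<in> dfield_gen \<iota> {r}"
  obtains a b c d where "a * d - b * c \<noteq> 0" "r = moebius \<iota> a b c d u"
proof (rule moebius_generator)
  show "transcendental_over (range \<iota>) r" using diff_transcendental_tower[OF r, of 0] by simp
  show "u \<notin> range \<iota>" by (rule diff_transcendental_not_const[OF u])
  show "r \<in> adjoin (range \<iota>) u" "u \<in> adjoin (range \<iota>) r"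
    using same_dfield_order_zero[OF assms] by simp_all
qed (rule that)

end

context same_vanishing
begin

lemma correspond_param_at:
  assumes "correspond \<eta> \<zeta> s t"
  shows "correspond \<eta> \<zeta> (coords (param_at \<iota> P s) v) (coords (param_at \<iota> P t) v)"
  by (cases v) (simp_all add: param_at_def correspond_divide correspond_subst assms)

lemma flip: "same_vanishing \<iota> \<zeta> \<eta>"
  by unfold_locales (simp add: vanish_iff)

end

context diff_extension
begin

text \<open>The points \<open>\<P>\<^sub>1(u)\<close> and \<open>\<P>\<^sub>2(u)\<close> satisfy the same differential equations, so there is an
isomorphism \<open>\<F>\<langle>\<P>\<^sub>1(u)\<rangle> \<rightarrow> \<F>\<langle>\<P>\<^sub>2(u)\<rangle>\<close> between the differential fields they generate. As both parametrizations are proper,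
it is an automorphism of \<open>\<F>\<langle>u\<rangle>\<close>. With \<open>r\<close> the image of \<open>u\<close>, it maps \<open>\<P>\<^sub>1(u)\<close> both to \<open>\<P>\<^sub>2(u)\<close>
and to \<open>\<P>\<^sub>1(r)\<close>; and \<open>r\<close>, being another generator of \<open>\<F>\<langle>u\<rangle>\<close>, is a Moebius transform of \<open>u\<close>.\<close>

lemma generic_points_moebius:
  assumes u: "diff_transcendental \<iota> u"
    and vanish: "vanishing_ideal \<iota> (param_at \<iota> P1 u) = vanishing_ideal \<iota> (param_at \<iota> P2 u)"
    and gen1: "dfield_gen \<iota> {fst (param_at \<iota> P1 u), snd (param_at \<iota> P1 u)} = dfield_gen \<iota> {u}"
    and gen2: "dfield_gen \<iota> {fst (param_at \<iota> P2 u), snd (param_at \<iota> P2 u)} = dfield_gen \<iota> {u}"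
  obtains a b c d where "a * d - b * c \<noteq> 0" "param_at \<iota> P2 u = param_at \<iota> P1 (moebius \<iota> a b c d u)"
proof -
  let ?\<eta> = "coords (param_at \<iota> P1 u)" and ?\<zeta> = "coords (param_at \<iota> P2 u)"
  interpret same_vanishing \<iota> ?\<eta> ?\<zeta>
    by unfold_locales (use vanish in \<open>unfold vanishing_ideal_def, blast\<close>)
  interpret flip: same_vanishing \<iota> ?\<zeta> ?\<eta> by (rule flip)
  have \<eta>: "dfield_gen \<iota> (range ?\<eta>) = dfield_gen \<iota> {u}" and \<zeta>: "dfield_gen \<iota> (range ?\<zeta>) = dfield_gen \<iota> {u}"
    unfolding range_coords by (rule gen1, rule gen2)
  have u_in: "u \<in> dfield_gen \<iota> {u}" using gen_subset_dfield_gen[of "{u}" \<iota>] by simp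
  from u_in obtain r where ur: "correspond ?\<eta> ?\<zeta> u r"
    unfolding \<eta>[symmetric] correspond_domain[symmetric] by blast
  from u_in obtain w where uw: "correspond ?\<zeta> ?\<eta> u w"
    unfolding \<zeta>[symmetric] flip.correspond_domain[symmetric] by blast
  have subst: "correspond ?\<eta> ?\<zeta> (deval \<iota> p (\<lambda>_::unit. u)) (deval \<iota> p (\<lambda>_. r))" for p
    by (rule correspond_subst) (rule ur)
  have "?\<zeta> v = coords (param_at \<iota> P1 r) v" for v
    using correspond_unique[OF correspond_gen correspond_param_at[OF ur]] .
  from this[of X] this[of Y] have param: "param_at \<iota> P2 u = param_at \<iota> P1 r" by (simp add: prod_eq_iff)
  have r: "diff_transcendental \<iota> r"
    unfolding diff_transcendental_def
  proof (intro allI impI)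
    fix p :: "(unit, 'f) dpoly"
    assume "deval \<iota> p (\<lambda>_. r) = 0"
    then have "deval \<iota> p (\<lambda>_. u) = 0" using correspond_0_iff[OF subst[of p]] by blast
    then show "p = 0" using u unfolding diff_transcendental_def by blast
  qed
  have "r \<in> {a. \<exists>b. correspond ?\<zeta> ?\<eta> a b}" using correspond_sym[OF ur] by blast
  then have ru: "r \<in> dfield_gen \<iota> {u}" unfolding flip.correspond_domain \<zeta> .
  have "w \<in> {a. \<exists>b. correspond ?\<eta> ?\<zeta> a b}" using correspond_sym[OF uw] by blast
  then have "w \<in> dfield_gen \<iota> (range (\<lambda>_::unit. u))" unfolding correspond_domain \<eta> by simp
  then obtain p q where "deval \<iota> q (\<lambda>_::unit. u) \<noteq> 0" "w = deval \<iota> p (\<lambda>_::unit. u) / deval \<iota> q (\<lambda>_. u)" by (rule dfield_gen_quotient)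
  then have "correspond ?\<eta> ?\<zeta> w (deval \<iota> p (\<lambda>_::unit. r) / deval \<iota> q (\<lambda>_. r))"
    using correspond_divide[OF subst[of p] subst[of q]] by simp
  from correspond_unique[OF correspond_sym[OF uw] this]
  have "u = deval \<iota> p (\<lambda>_::unit. r) / deval \<iota> q (\<lambda>_. r)" .
  moreover have "range (\<lambda>_::unit. r) \<subseteq> dfield_gen \<iota> {r}" using gen_subset_dfield_gen[of "{r}" \<iota>] by simp
  ultimately have "u \<in> dfield_gen \<iota> {r}" using quotient_in_dfield by metis
  from automorphism_moebius[OF u r ru this] obtain a b c d
    where "a * d - b * c \<noteq> 0" "r = moebius \<iota> a b c d u" .
  then show ?thesis using that param by blast
qed

text \<open>The substitution of \<open>r = m(u)\<close> for \<open>u\<close> is an isomorphism \<open>\<F>\<langle>u\<rangle> \<rightarrow> \<F>\<langle>r\<rangle>\<close>, because both elements are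
differentially transcendental. It maps \<open>\<P>(u)\<close> to \<open>\<P>(r)\<close>, so the two points have the same vanishing
ideal, and it maps an expression of \<open>u\<close> in terms of \<open>\<P>(u)\<close> to one of \<open>r\<close> in terms of \<open>\<P>(r)\<close>;
since \<open>u\<close> is a Moebius transform of \<open>r\<close>, the new parametrization is proper.\<close>

lemma moebius_reparametrization:
  assumes u: "diff_transcendental \<iota> u" and det: "a * d - b * c \<noteq> 0"
    and P: "proper_parametrization \<iota> R u C A P" and C: "C = zero_set \<iota> (sat R A)"
  obtains Q where "proper_parametrization \<iota> R u C A Q"
    "param_at \<iota> Q u = param_at \<iota> P (moebius \<iota> a b c d u)"
proof -
  define r where "r = moebius \<iota> a b c d u"
  have r: "diff_transcendental \<iota> r" unfolding r_def by (rule diff_transcendental_moebius[OF u det])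
  let ?\<eta> = "\<lambda>_::unit. u" and ?\<zeta> = "\<lambda>_::unit. r"
  let ?Pu = "coords (param_at \<iota> P u)" and ?Pr = "coords (param_at \<iota> P r)"
  interpret same_vanishing \<iota> ?\<eta> ?\<zeta>
  proof
    fix p :: "(unit, 'f) dpoly"
    show "deval \<iota> p ?\<eta> = 0 \<longleftrightarrow> deval \<iota> p ?\<zeta> = 0"
      using u r deval_0 unfolding diff_transcendental_def by metis
  qed
  have subst: "correspond ?\<eta> ?\<zeta> (deval \<iota> f ?Pu) (deval \<iota> f ?Pr)" for f
    by (intro correspond_subst correspond_param_at correspond_gen[of ?\<eta> ?\<zeta> "()"])
  have r_in: "r \<in> dfield_gen \<iota> {u}"
    unfolding r_def using gen_subset_dfield_gen[of "{u}" \<iota>]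
    by (intro moebius_in_dfield differential_subfield_dfield_gen range_subset_dfield_gen) simp
  then have sub: "dfield_gen \<iota> {r} \<subseteq> dfield_gen \<iota> {u}" by (intro dfield_gen_subset) simp
  have Pr_in: "fst (param_at \<iota> P r) \<in> dfield_gen \<iota> {u}" "snd (param_at \<iota> P r) \<in> dfield_gen \<iota> {u}"
    using param_at_in_dfield sub by blast+
  obtain p1 q1 where Q1: "q1 \<noteq> 0" "gcd_one p1 q1" "fst (param_at \<iota> P r) = deval \<iota> p1 ?\<eta> / deval \<iota> q1 ?\<eta>"
    by (rule reduced_quotient[OF u Pr_in(1)])
  obtain p2 q2 where Q2: "q2 \<noteq> 0" "gcd_one p2 q2" "snd (param_at \<iota> P r) = deval \<iota> p2 ?\<eta> / deval \<iota> q2 ?\<eta>"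
    by (rule reduced_quotient[OF u Pr_in(2)])
  define Q where "Q = \<lparr>num1 = p1, den1 = q1, num2 = p2, den2 = q2\<rparr>"
  have Q: "param_at \<iota> Q u = param_at \<iota> P r"
    unfolding param_at_def[of _ Q] by (simp add: Q_def prod_eq_iff Q1(3) Q2(3))
  have "reduced Q" using Q1 Q2 by (simp add: reduced_def Q_def)
  moreover have "vanishing_ideal \<iota> (param_at \<iota> P r) = vanishing_ideal \<iota> (param_at \<iota> P u)"
    unfolding vanishing_ideal_def using correspond_0_iff[OF subst] by blast
  then have sat: "vanishing_ideal \<iota> (param_at \<iota> Q u) = sat R A"
    using P by (simp add: Q proper_parametrization_def rational_parametrization_def generic_point_def)
  moreover have "param_at \<iota> Q u \<in> C"
    unfolding C zero_set_def sat[symmetric] vanishing_ideal_def by blast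
  moreover have "dfield_gen \<iota> {fst (param_at \<iota> P r), snd (param_at \<iota> P r)} = dfield_gen \<iota> {u}"
  proof
    show "dfield_gen \<iota> {fst (param_at \<iota> P r), snd (param_at \<iota> P r)} \<subseteq> dfield_gen \<iota> {u}"
      using Pr_in by (intro dfield_gen_subset) blast
    have "u \<in> dfield_gen \<iota> (range ?Pu)"
      using P gen_subset_dfield_gen[of "{u}" \<iota>] unfolding proper_parametrization_def range_coords by simp
    then obtain p q where "deval \<iota> q ?Pu \<noteq> 0" "u = deval \<iota> p ?Pu / deval \<iota> q ?Pu" by (rule dfield_gen_quotient)
    then have "correspond ?\<eta> ?\<zeta> u (deval \<iota> p ?Pr / deval \<iota> q ?Pr)"
      using correspond_divide[OF subst[of p] subst[of q]] by simp
    from correspond_unique[OF correspond_gen[of ?\<eta> ?\<zeta> "()"] this]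
    have "r = deval \<iota> p ?Pr / deval \<iota> q ?Pr" .
    then have "r \<in> dfield_gen \<iota> (range ?Pr)" using quotient_in_dfield[OF gen_subset_dfield_gen] by metis
    then have "moebius \<iota> d (- b) (- c) a r \<in> dfield_gen \<iota> (range ?Pr)"
      by (intro moebius_in_dfield differential_subfield_dfield_gen range_subset_dfield_gen)
    then have "u \<in> dfield_gen \<iota> (range ?Pr)"
      unfolding r_def using moebius_inverse(3)[OF diff_transcendental_not_const[OF u] det] by simp
    then show "dfield_gen \<iota> {u} \<subseteq> dfield_gen \<iota> {fst (param_at \<iota> P r), snd (param_at \<iota> P r)}"
      unfolding range_coords by (intro dfield_gen_subset) simp
  qed
  ultimately have "proper_parametrization \<iota> R u C A Q"
    unfolding proper_parametrization_def rational_parametrization_def generic_point_def Q by blast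
  then show ?thesis using that Q unfolding r_def by blast
qed

end

theorem theorem3p10:
  fixes \<iota> :: "'f::differential_field \<Rightarrow> 'e::differential_field"
    and R :: "(plane_var \<times> nat) rel"
    and u :: 'e
    and C :: "('e \<times> 'e) set"
    and A :: "(plane_var, 'f) dpoly"
  assumes "universal_extension \<iota>"
    and "ranking R"
    and "diff_transcendental \<iota> u"
    and "irreducible_curve \<iota> R C A"
    and "unirational \<iota> R u C A"
  shows "(\<forall>P1 P2. proper_parametrization \<iota> R u C A P1 \<and> proper_parametrization \<iota> R u C A P2 \<longrightarrow>
            (\<exists>a b c d. a * d - b * c \<noteq> 0 \<and>
               param_at \<iota> P2 u = param_at \<iota> P1 (moebius \<iota> a b c d u))) \<and>
         (\<forall>P. proper_parametrization \<iota> R u C A P \<longrightarrow>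
            (\<forall>a b c d. a * d - b * c \<noteq> 0 \<longrightarrow>
               (\<exists>Q. proper_parametrization \<iota> R u C A Q \<and>
                    param_at \<iota> Q u = param_at \<iota> P (moebius \<iota> a b c d u))))"
proof -
  interpret diff_extension \<iota>
    using assms(1) by unfold_locales (simp add: universal_extension_def)
  have C: "C = zero_set \<iota> (sat R A)" using assms(4) by (simp add: irreducible_curve_def)
  show ?thesis
  proof (intro conjI allI impI)
    fix P1 P2
    assume *: "proper_parametrization \<iota> R u C A P1 \<and> proper_parametrization \<iota> R u C A P2"
    show "\<exists>a b c d. a * d - b * c \<noteq> 0 \<and> param_at \<iota> P2 u = param_at \<iota> P1 (moebius \<iota> a b c d u)"
    proof (rule generic_points_moebius[OF assms(3)])
      show "vanishing_ideal \<iota> (param_at \<iota> P1 u) = vanishing_ideal \<iota> (param_at \<iota> P2 u)"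
        "dfield_gen \<iota> {fst (param_at \<iota> P1 u), snd (param_at \<iota> P1 u)} = dfield_gen \<iota> {u}"
        "dfield_gen \<iota> {fst (param_at \<iota> P2 u), snd (param_at \<iota> P2 u)} = dfield_gen \<iota> {u}"
        using * by (simp_all add: proper_parametrization_def rational_parametrization_def generic_point_def)
    qed blast
  next
    fix P and a b c d :: 'f
    assume "proper_parametrization \<iota> R u C A P" "a * d - b * c \<noteq> 0"
    then show "\<exists>Q. proper_parametrization \<iota> R u C A Q \<and> param_at \<iota> Q u = param_at \<iota> P (moebius \<iota> a b c d u)"
      using moebius_reparametrization[OF assms(3) _ _ C] by metis
  qed
qed

end
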